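(* Let $q\ge 1$ be an integer, let $0<\alpha<1$, and let $f_X$ be a probability density on $\mathbb{R}$ with $\int |x|^{2q} f_X(x)\,dx<\infty$ (the density of the covariate in polynomial regression of degree $q$). A subsampling design $\xi^*$ (of mass $\alpha$, with density bounded by $f_X$) is $D$-optimal if and only if there exist a threshold $s^*\in\mathbb{R}$, an integer $r$ with $1\le r\le q$, and settings $a_1>a_2>\dots>a_{2r}$ in $\mathbb{R}$ such that, with $$\mathcal{I}_0=[a_1,\infty),\qquad \mathcal{I}_k=[a_{2k+1},a_{2k}]\ \ (k=1,\dots,r-1),\qquad \mathcal{I}_r=(-\infty,a_{2r}]$$ (mutually disjoint intervals) and $\mathcal{X}^*=\bigcup_{k=0}^r\mathcal{I}_k$, the following hold: (i) $\xi^*$ has density $f_{\xi^*}(x)=f_X(x)$ if $x\in\mathcal{X}^*$ and $f_{\xi^*}(x)=0$ otherwise; (ii) $\psi(x,\xi^* )\ge s^*$ for all $x\in\mathcal{X}^*$; (iii) $\psi(x,\xi^* )<s^*$ for all $x\notin\mathcal{X}^*$.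
   Context: Polynomial regression of degree $q$: $\mathbf{f}(x)=(1,x,\dots,x^q)^\top$, $p=q+1$. A (continuous) subsampling design $\xi$ is a measure on $\mathbb{R}$ with Lebesgue density $f_\xi$ satisfying $0\le f_\xi(x)\le f_X(x)$ for all $x$ and $\int f_\xi(x)\,dx=\alpha$ (densities are understood up to Lebesgue null sets). Its information matrix is the $p\times p$ matrix $\mathbf{M}(\xi)=\int \mathbf{f}(x)\mathbf{f}(x)^\top f_\xi(x)\,dx$, which is always nonsingular. A subsampling design is $D$-optimal if it maximizes $\log\det\mathbf{M}(\xi)$ among all subsampling designs $\xi$ (for the given $f_X$, $\alpha$, $q$). The sensitivity function is $\psi(x,\xi)=\alpha\,\mathbf{f}(x)^\top\mathbf{M}(\xi)^{-1}\mathbf{f}(x)$.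
   Formalization: The settings satisfy a_1 > a_2 ≥ a_3 > a_4 ≥ … > a_{2r} instead of being strictly decreasing, so an inner interval I_k may be a single point; with strict ordering "only if" fails when ψ touches s* from below at an inner local maximum (possible for q = 2). *)

theory Defs
  imports
    "HOL-Analysis.Analysis"
    "Jordan_Normal_Form.Determinant"
    "Jordan_Normal_Form.Gauss_Jordan_Elimination"
begin

(* Matrices and vectors have the size q + 1, where q is a term, so they are those of
   Jordan_Normal_Form; the names det, vec and $ of HOL-Analysis are put out of the way. *)
hide_const (open) Determinants.det Finite_Cartesian_Product.vec
no_notation Finite_Cartesian_Product.vec_nth (infixl \<open>$\<close> 90)

definition regression_vec :: "nat \<Rightarrow> real \<Rightarrow> real vec" where
  "regression_vec q x = vec (q + 1) (\<lambda>i. x ^ i)"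

(* A design is a measure, so densities that agree almost everywhere give the same design. *)
definition subsampling_design :: "(real \<Rightarrow> real) \<Rightarrow> real \<Rightarrow> real measure \<Rightarrow> bool" where
  "subsampling_design fX \<alpha> \<xi> \<longleftrightarrow>
     (\<exists>f \<in> borel_measurable lborel.
        (\<forall>x. 0 \<le> f x \<and> f x \<le> fX x) \<and>
        has_bochner_integral lborel f \<alpha> \<and>
        \<xi> = density lborel (\<lambda>x. ennreal (f x)))"

definition info_matrix :: "nat \<Rightarrow> real measure \<Rightarrow> real mat" where
  "info_matrix q \<xi> = mat (q + 1) (q + 1)
     (\<lambda>(i, j). LINT x|\<xi>. regression_vec q x $ i * regression_vec q x $ j)"

definition D_optimal :: "nat \<Rightarrow> (real \<Rightarrow> real) \<Rightarrow> real \<Rightarrow> real measure \<Rightarrow> bool" where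
  "D_optimal q fX \<alpha> \<xi> \<longleftrightarrow>
     subsampling_design fX \<alpha> \<xi> \<and>
     (\<forall>\<eta>. subsampling_design fX \<alpha> \<eta> \<longrightarrow>
        ln (det (info_matrix q \<eta>)) \<le> ln (det (info_matrix q \<xi>)))"

(* mat_inverse returns None exactly on singular matrices; the information matrix of a
   subsampling design is never singular, so "the" is applied only to a Some value. *)
definition sensitivity :: "nat \<Rightarrow> real \<Rightarrow> real measure \<Rightarrow> real \<Rightarrow> real" where
  "sensitivity q \<alpha> \<xi> x =
     \<alpha> * (regression_vec q x \<bullet> (the (mat_inverse (info_matrix q \<xi>)) *\<^sub>v regression_vec q x))"

(* The settings are a 1, ..., a (2 * r); other values of a are irrelevant. *)
definition support_interval :: "(nat \<Rightarrow> real) \<Rightarrow> nat \<Rightarrow> nat \<Rightarrow> real set" where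
  "support_interval a r k =
     (if k = 0 then {a 1..}
      else if k < r then {a (2 * k + 1)..a (2 * k)}
      else {..a (2 * r)})"

(* a 1 > a 2 \<ge> a 3 > a 4 \<ge> ... > a (2 * r).  The strict inequalities are the ones that make the
   support intervals mutually disjoint.  An inner interval [a (2 * k + 1), a (2 * k)] may be a
   single point: the sensitivity function can touch the threshold from below at an inner local
   maximum, as it does for q = 2 at the transition from two to three support intervals.  With
   a 2 > a 3, a 4 > a 5, ... such optimal designs would have no representation. *)
definition ordered_settings :: "(nat \<Rightarrow> real) \<Rightarrow> nat \<Rightarrow> bool" where
  "ordered_settings a r \<longleftrightarrow>
     (\<forall>k \<in> {1..r}. a (2 * k - 1) > a (2 * k)) \<and>
     (\<forall>k \<in> {1..<r}. a (2 * k) \<ge> a (2 * k + 1))"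

end

theory Submission
  imports Defs
begin

text \<open>
  Write \<open>M\<close> for the information matrix of a design with density \<open>f\<close> and \<open>W\<close> for its inverse. For
  positive definite matrices, \<open>ln (det A) - ln (det M) \<le> tr (W A) - n\<close>: after a congruence that turns
  \<open>M\<close> into the identity this is Hadamard's inequality. Hence \<open>f\<close> is optimal if and only if
  \<open>\<integral> \<psi> (g - f) \<le> 0\<close> for all competing densities \<open>g\<close>. If \<open>f\<close> equals \<open>fX\<close> where \<open>\<psi> \<ge> s\<close> and
  vanishes elsewhere, then \<open>(\<psi> - s) (g - f) \<le> 0\<close> pointwise. Conversely, since the level sets of the
  polynomial \<open>\<psi>\<close> are null, there is a threshold \<open>s\<close> for which the truncation \<open>g\<close> of \<open>fX\<close> to
  \<open>\<psi> \<ge> s\<close> has mass \<open>\<alpha>\<close>; for it \<open>(\<psi> - s) (g - f)\<close> is nonnegative with nonpositive integral, so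
  \<open>f = g\<close> almost everywhere. Finally \<open>\<psi>\<close> has degree at most \<open>2 q\<close> and tends to infinity on both
  sides, so \<open>\<psi> < s\<close> holds on at most \<open>q\<close> bounded open intervals.
\<close>

section \<open>Positive definite matrices\<close>

text \<open>Vectors are plain functions of which only the values below \<open>n\<close> count, so
  differences, sums and unit vectors carry no dimension side conditions;
  \<open>bilin_scalar_prod\<close> leads back to matrix products.\<close>

definition bilin :: "nat \<Rightarrow> real mat \<Rightarrow> (nat \<Rightarrow> real) \<Rightarrow> (nat \<Rightarrow> real) \<Rightarrow> real" where
  "bilin n A u v = (\<Sum>i<n. \<Sum>j<n. u i * A $$ (i, j) * v j)"

definition pos_def_mat :: "nat \<Rightarrow> real mat \<Rightarrow> bool" where
  "pos_def_mat n A \<longleftrightarrow> A \<in> carrier_mat n n \<and> (\<forall>i<n. \<forall>j<n. A $$ (i, j) = A $$ (j, i)) \<and>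
     (\<forall>v. (\<exists>i<n. v i \<noteq> 0) \<longrightarrow> 0 < bilin n A v v)"

lemma bilin_diff_left: "bilin n A (\<lambda>i. u i - v i) w = bilin n A u w - bilin n A v w"
  by (simp add: bilin_def algebra_simps sum_subtractf)

lemma bilin_cmult_left: "bilin n A (\<lambda>i. c * u i) w = c * bilin n A u w"
  by (simp add: bilin_def sum_distrib_left mult.assoc)

lemma bilin_zero_left: "bilin n A (\<lambda>i. 0) w = 0"
  by (simp add: bilin_def)

lemma bilin_add_left: "bilin n A (\<lambda>i. u i + v i) w = bilin n A u w + bilin n A v w"
  by (simp add: bilin_def algebra_simps sum.distrib)

lemma bilin_sum_left:
  "finite S \<Longrightarrow> bilin n A (\<lambda>i. \<Sum>k\<in>S. u k i) w = (\<Sum>k\<in>S. bilin n A (u k) w)"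
  by (induction S rule: finite_induct) (simp_all add: bilin_zero_left bilin_add_left)

lemma bilin_commute:
  assumes "\<And>i j. i < n \<Longrightarrow> j < n \<Longrightarrow> A $$ (i, j) = A $$ (j, i)"
  shows "bilin n A u v = bilin n A v u"
  unfolding bilin_def
  by (subst sum.swap) (auto intro!: sum.cong simp: assms mult.commute mult.left_commute)

lemma bilin_unit:
  assumes "k < n"
  shows "bilin n A (\<lambda>i. if i = k then 1 else 0) (\<lambda>i. if i = k then 1 else 0) = A $$ (k, k)"
proof -
  have "bilin n A (\<lambda>i. if i = k then 1 else 0) (\<lambda>i. if i = k then 1 else 0) =
      (\<Sum>i<n. \<Sum>j<n. if j = k then if i = k then A $$ (i, j) else 0 else 0)"
    unfolding bilin_def by (intro sum.cong) auto
  then show ?thesis using assms by simp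
qed

lemma bilin_scalar_prod:
  "A \<in> carrier_mat n n \<Longrightarrow> bilin n A u v = vec n u \<bullet> (A *\<^sub>v vec n v)"
  by (auto simp: bilin_def scalar_prod_def sum_distrib_left mult.assoc atLeast0LessThan
      intro!: sum.cong)

lemma pos_def_bilin_pos: "pos_def_mat n A \<Longrightarrow> i < n \<Longrightarrow> v i \<noteq> 0 \<Longrightarrow> 0 < bilin n A v v"
  by (auto simp: pos_def_mat_def)

lemma pos_def_diag_pos: "pos_def_mat n A \<Longrightarrow> k < n \<Longrightarrow> 0 < A $$ (k, k)"
  using pos_def_bilin_pos[of n A k "\<lambda>i. if i = k then 1 else 0"] bilin_unit[of k n A] by simp

section \<open>Orthogonalization and Hadamard's inequality\<close>

text \<open>Gram-Schmidt for the inner product given by \<open>A\<close>, applied to the unit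
  vectors without normalization. Each vector keeps leading coefficient 1, and removing a projection
  can only shorten it, which gives the bound by the diagonal entry.\<close>

lemma gram_schmidt_exists:
  assumes A: "pos_def_mat n A" and "m \<le> n"
  shows "\<exists>t. \<forall>k<m. t k k = 1 \<and> (\<forall>j>k. t k j = 0) \<and> (\<forall>j<k. bilin n A (t k) (t j) = 0) \<and>
           bilin n A (t k) (t k) \<le> A $$ (k, k)"
  using \<open>m \<le> n\<close>
proof (induction m)
  case 0
  then show ?case by simp
next
  case (Suc m)
  then obtain t where t: "\<And>k. k < m \<Longrightarrow> t k k = 1"
    "\<And>k j. k < m \<Longrightarrow> k < j \<Longrightarrow> t k j = 0"
    "\<And>k j. k < m \<Longrightarrow> j < k \<Longrightarrow> bilin n A (t k) (t j) = 0"
    "\<And>k. k < m \<Longrightarrow> bilin n A (t k) (t k) \<le> A $$ (k, k)"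
    by auto
  have comm: "bilin n A u v = bilin n A v u" for u v
    using A by (intro bilin_commute) (auto simp: pos_def_mat_def)
  have pos: "0 < bilin n A (t k) (t k)" if "k < m" for k
  proof -
    have "t k k \<noteq> 0" using t(1) that by simp
    then show ?thesis using that Suc.prems by (intro pos_def_bilin_pos[OF A, of k]) auto
  qed
  define e :: "nat \<Rightarrow> real" where "e = (\<lambda>i. if i = m then 1 else 0)"
  \<comment> \<open>Coefficient of the projection of \<open>e\<close> onto \<open>t k\<close>;
    \<open>w\<close> is what remains of \<open>e\<close> after all projections are removed.\<close>
  define c where "c k = bilin n A e (t k) / bilin n A (t k) (t k)" for k
  define w where "w = (\<lambda>i. e i - (\<Sum>k<m. c k * t k i))"
  have w_left: "bilin n A w v = bilin n A e v - (\<Sum>k<m. c k * bilin n A (t k) v)" for v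
    unfolding w_def by (simp add: bilin_diff_left bilin_sum_left bilin_cmult_left)
  have orth: "bilin n A w (t j) = 0" if "j < m" for j
  proof -
    have "c k * bilin n A (t k) (t j) = (if k = j then bilin n A e (t j) else 0)" if "k < m" for k
      using t(3)[of k j] t(3)[of j k] comm[of "t j" "t k"] pos[of k] that \<open>j < m\<close>
      by (cases k j rule: linorder_cases) (auto simp: c_def)
    then have "(\<Sum>k<m. c k * bilin n A (t k) (t j)) = (\<Sum>k<m. if k = j then bilin n A e (t j) else 0)"
      by (intro sum.cong) auto
    then show ?thesis using that by (simp add: w_left)
  qed
  \<comment> \<open>Orthogonality of \<open>w\<close> to all \<open>t k\<close> allows one
    \<open>w\<close> to be replaced by \<open>e\<close>; expanding the other leaves the diagonal
    entry minus nonnegative terms.\<close>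
  have "bilin n A w w = bilin n A w e - (\<Sum>k<m. c k * bilin n A (t k) w)"
    using w_left[of w] by (simp add: comm)
  also have "\<dots> = bilin n A w e"
    using orth by (simp add: comm)
  also have "\<dots> = A $$ (m, m) - (\<Sum>k<m. c k * bilin n A e (t k))"
  proof -
    have "bilin n A e e = A $$ (m, m)"
      unfolding e_def using Suc.prems by (intro bilin_unit) simp
    then show ?thesis unfolding w_left comm[of "t _" e] by simp
  qed
  also have "\<dots> \<le> A $$ (m, m)"
  proof -
    have "0 \<le> c k * bilin n A e (t k)" if "k < m" for k
      using pos[OF that] by (simp add: c_def)
    then have "0 \<le> (\<Sum>k<m. c k * bilin n A e (t k))" by (intro sum_nonneg) auto
    then show ?thesis by simp
  qed
  finally have norm: "bilin n A w w \<le> A $$ (m, m)" .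
  have wm: "w m = 1" "\<And>j. m < j \<Longrightarrow> w j = 0"
    using t(2) by (auto simp: w_def e_def)
  show ?case
    by (rule exI[of _ "t(m := w)"])
      (use t orth norm wm in \<open>auto simp: less_Suc_eq\<close>)
qed

lemma index_congruence:
  assumes "L \<in> carrier_mat n n" "A \<in> carrier_mat n n" "i < n" "j < n"
  shows "(L * A * transpose_mat L) $$ (i, j) = bilin n A (\<lambda>k. L $$ (i, k)) (\<lambda>k. L $$ (j, k))"
proof -
  have "L * A * transpose_mat L = L * (A * transpose_mat L)"
    using assms by (intro assoc_mult_mat) auto
  then show ?thesis using assms
    by (auto simp: bilin_def scalar_prod_def sum_distrib_left mult.assoc atLeast0LessThan
      intro!: sum.cong)
qed

text \<open>The orthogonal vectors are the rows of \<open>L\<close>. The congruence tabulates their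
  mutual inner products, hence is diagonal, and \<open>L\<close> is lower triangular with ones on
  the diagonal, hence has determinant 1.\<close>

lemma pos_def_diagonalize:
  assumes A: "pos_def_mat n A"
  shows "\<exists>L d. L \<in> carrier_mat n n \<and> det L = 1 \<and> L * A * transpose_mat L = mat_diag n d \<and>
           (\<forall>k<n. 0 < d k \<and> d k \<le> A $$ (k, k))"
proof -
  obtain t where t: "\<And>k. k < n \<Longrightarrow> t k k = 1"
    "\<And>k j. k < n \<Longrightarrow> k < j \<Longrightarrow> t k j = 0"
    "\<And>k j. k < n \<Longrightarrow> j < k \<Longrightarrow> bilin n A (t k) (t j) = 0"
    "\<And>k. k < n \<Longrightarrow> bilin n A (t k) (t k) \<le> A $$ (k, k)"
    using gram_schmidt_exists[OF A order_refl] by auto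
  have Ac: "A \<in> carrier_mat n n" and comm: "bilin n A u v = bilin n A v u" for u v
    using A by (auto simp: pos_def_mat_def intro!: bilin_commute)
  have pos: "0 < bilin n A (t k) (t k)" if "k < n" for k
    using that t(1)[OF that] by (intro pos_def_bilin_pos[OF A that]) simp
  define L where "L = mat n n (\<lambda>(i, j). t i j)"
  define d where "d k = bilin n A (t k) (t k)" for k
  have Lc: "L \<in> carrier_mat n n" by (simp add: L_def)
  have "det L = prod_list (diag_mat L)"
    by (rule det_lower_triangular[OF _ Lc]) (simp add: L_def t)
  also have "\<dots> = (\<Prod>i<n. L $$ (i, i))"
    by (simp add: prod_list_diag_prod L_def atLeast0LessThan)
  also have "\<dots> = 1" by (simp add: L_def t)
  finally have det: "det L = 1" .
  have row: "bilin n A (\<lambda>k. L $$ (i, k)) (\<lambda>k. L $$ (j, k)) = bilin n A (t i) (t j)"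
    if "i < n" "j < n" for i j
    using that by (simp add: bilin_def L_def)
  have "L * A * transpose_mat L = mat_diag n d"
  proof (rule eq_matI)
    fix i j assume "i < dim_row (mat_diag n d)" "j < dim_col (mat_diag n d)"
    then have ij: "i < n" "j < n" by (auto simp: mat_diag_def)
    then show "(L * A * transpose_mat L) $$ (i, j) = mat_diag n d $$ (i, j)"
      using t(3)[of i j] t(3)[of j i] comm[of "t i" "t j"]
      by (cases i j rule: linorder_cases)
        (auto simp del: index_mult_mat simp: index_congruence[OF Lc Ac] row mat_diag_def d_def)
  qed (use Lc in \<open>auto simp: mat_diag_def\<close>)
  then show ?thesis using Lc det pos t(4) unfolding d_def by blast
qed

text \<open>The diagonalizing congruence preserves the determinant, so \<open>det A\<close> is the
  product of the pivots \<open>d k\<close>, and each pivot is positive and at most the matching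
  diagonal entry.\<close>

lemma hadamard_inequality:
  assumes A: "pos_def_mat n A"
  shows "0 < det A" and "det A \<le> (\<Prod>k<n. A $$ (k, k))"
proof -
  obtain L d where L: "L \<in> carrier_mat n n" "det L = 1" "L * A * transpose_mat L = mat_diag n d"
    and d: "\<And>k. k < n \<Longrightarrow> 0 < d k \<and> d k \<le> A $$ (k, k)"
    using pos_def_diagonalize[OF A] by blast
  have Ac: "A \<in> carrier_mat n n" using A by (simp add: pos_def_mat_def)
  have "det (L * A * transpose_mat L) = det (L * A) * det (transpose_mat L)"
    using L(1) Ac by (intro det_mult) auto
  also have "\<dots> = det A"
    using L(1,2) Ac by (simp add: det_mult[of _ n] det_transpose[of _ n])
  finally have "det (L * A * transpose_mat L) = det A" .
  moreover have "det (mat_diag n d) = (\<Prod>k<n. d k)"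
    by (subst det_lower_triangular[of n])
      (auto simp: prod_list_diag_prod mat_diag_def atLeast0LessThan)
  ultimately have det: "det A = (\<Prod>k<n. d k)" using L(3) by simp
  show "0 < det A" unfolding det using d by (auto intro: prod_pos)
  show "det A \<le> (\<Prod>k<n. A $$ (k, k))" unfolding det using d by (intro prod_mono) (auto intro: less_imp_le)
qed

text \<open>Dividing the rows of the diagonalizing matrix by the square roots of the pivots turns
  the diagonal into the identity.\<close>

lemma pos_def_normalize:
  assumes A: "pos_def_mat n A"
  shows "\<exists>L \<in> carrier_mat n n. L * A * transpose_mat L = 1\<^sub>m n"
proof -
  obtain L d where L: "L \<in> carrier_mat n n" "L * A * transpose_mat L = mat_diag n d"
    and d: "\<And>k. k < n \<Longrightarrow> 0 < d k"
    using pos_def_diagonalize[OF A] by blast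
  have Ac: "A \<in> carrier_mat n n" using A by (simp add: pos_def_mat_def)
  define D where "D = mat_diag n (\<lambda>k. 1 / sqrt (d k))"
  have Dc: "D \<in> carrier_mat n n" by (simp add: D_def)
  have Dt: "transpose_mat D = D" by (rule eq_matI) (auto simp: D_def mat_diag_def)
  have "(D * L) * A * transpose_mat (D * L) = D * (L * A * transpose_mat L) * D"
    using L(1) Ac Dc Dt
    by (simp add: transpose_mult[of _ n n] assoc_mult_mat[of _ n n _ n _ n])
  also have "\<dots> = mat_diag n (\<lambda>k. 1 / sqrt (d k) * d k * (1 / sqrt (d k)))"
    by (simp add: L(2) D_def)
  also have "\<dots> = 1\<^sub>m n"
    using d by (intro eq_matI) (auto simp: mat_diag_def real_sqrt_mult_self less_imp_le less_imp_neq[symmetric])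
  finally have "(D * L) * A * transpose_mat (D * L) = 1\<^sub>m n" .
  moreover have "D * L \<in> carrier_mat n n" using Dc L by simp
  ultimately show ?thesis by blast
qed

lemma bilin_congruence:
  assumes L: "L \<in> carrier_mat n n" and A: "A \<in> carrier_mat n n"
  shows "bilin n (L * A * transpose_mat L) v v =
    bilin n A (\<lambda>k. \<Sum>i<n. L $$ (i, k) * v i) (\<lambda>k. \<Sum>i<n. L $$ (i, k) * v i)"
proof -
  define u where "u = vec n (\<lambda>k. \<Sum>i<n. L $$ (i, k) * v i)"
  have u: "transpose_mat L *\<^sub>v vec n v = u"
    using L by (auto simp: u_def scalar_prod_def atLeast0LessThan)
  have "bilin n (L * A * transpose_mat L) v v = vec n v \<bullet> (L * A * transpose_mat L *\<^sub>v vec n v)"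
    using L A by (intro bilin_scalar_prod) simp
  also have "L * A * transpose_mat L *\<^sub>v vec n v = L *\<^sub>v (A *\<^sub>v u)"
    using L A by (simp flip: u add: assoc_mult_mat_vec[of _ n n _ n])
  also have "vec n v \<bullet> (L *\<^sub>v (A *\<^sub>v u)) = u \<bullet> (A *\<^sub>v u)"
    using transpose_vec_mult_scalar[of L n n "A *\<^sub>v u" "vec n v"] L A
    by (simp add: u u_def)
  finally show ?thesis using bilin_scalar_prod[OF A] by (simp add: u_def)
qed

section \<open>Concavity of the log-determinant\<close>

text \<open>The form at \<open>v\<close> becomes the form of \<open>A\<close> at \<open>u\<close>,
  the transpose of \<open>L\<close> applied to \<open>v\<close>. The right inverse \<open>K\<close>
  recovers \<open>v\<close> from \<open>u\<close>, so \<open>u\<close> cannot vanish when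
  \<open>v\<close> does not.\<close>

lemma pos_def_congruence:
  assumes A: "pos_def_mat n A" and L: "L \<in> carrier_mat n n"
    and K: "K \<in> carrier_mat n n" "L * K = 1\<^sub>m n"
  shows "pos_def_mat n (L * A * transpose_mat L)"
  unfolding pos_def_mat_def
proof (intro conjI allI impI)
  have Ac: "A \<in> carrier_mat n n" using A by (simp add: pos_def_mat_def)
  show "L * A * transpose_mat L \<in> carrier_mat n n" using Ac L by simp
  show "(L * A * transpose_mat L) $$ (i, j) = (L * A * transpose_mat L) $$ (j, i)"
    if "i < n" "j < n" for i j
    unfolding index_congruence[OF L Ac that] index_congruence[OF L Ac that(2,1)]
    using A by (intro bilin_commute) (auto simp: pos_def_mat_def)
  fix v :: "nat \<Rightarrow> real" assume v: "\<exists>i<n. v i \<noteq> 0"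
  define u where "u k = (\<Sum>i<n. L $$ (i, k) * v i)" for k
  have "\<exists>k<n. u k \<noteq> 0"
  proof (rule ccontr)
    assume "\<not> (\<exists>k<n. u k \<noteq> 0)"
    then have u0: "u k = 0" if "k < n" for k using that by auto
    have "v j = 0" if "j < n" for j
    proof -
      have "v j = (\<Sum>i<n. if i = j then v i else 0)" using that by simp
      also have "\<dots> = (\<Sum>i<n. v i * (L * K) $$ (i, j))"
        using that unfolding K(2) by (intro sum.cong) simp_all
      also have "\<dots> = (\<Sum>i<n. \<Sum>k<n. v i * (L $$ (i, k) * K $$ (k, j)))"
        using L K(1) that by (auto simp: scalar_prod_def atLeast0LessThan sum_distrib_left intro!: sum.cong)
      also have "\<dots> = (\<Sum>k<n. u k * K $$ (k, j))"
        by (subst sum.swap) (auto simp: u_def sum_distrib_right sum_distrib_left mult_ac intro!: sum.cong)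
      also have "\<dots> = 0" by (simp add: u0)
      finally show ?thesis .
    qed
    then show False using v by blast
  qed
  then show "0 < bilin n (L * A * transpose_mat L) v v"
    using A unfolding bilin_congruence[OF L Ac] u_def[symmetric] pos_def_mat_def by blast
qed

text \<open>A congruence that normalizes \<open>B\<close> also factors its inverse:
  \<open>B * transpose_mat L\<close> is the inverse \<open>K\<close> of \<open>L\<close>, and
  inserting \<open>K * L = 1\<close> after \<open>W\<close> cancels \<open>W\<close> against
  \<open>B\<close>.\<close>

lemma pos_def_inverse_factor:
  assumes B: "pos_def_mat n B" and W: "W \<in> carrier_mat n n" "B * W = 1\<^sub>m n"
  obtains L K where "L \<in> carrier_mat n n" "K \<in> carrier_mat n n" "L * K = 1\<^sub>m n" "K * L = 1\<^sub>m n"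
    "L * B * transpose_mat L = 1\<^sub>m n" "W = transpose_mat L * L"
proof -
  have Bc: "B \<in> carrier_mat n n" using B by (simp add: pos_def_mat_def)
  obtain L where L: "L \<in> carrier_mat n n" "L * B * transpose_mat L = 1\<^sub>m n"
    using pos_def_normalize[OF B] by blast
  define K where "K = B * transpose_mat L"
  have K: "K \<in> carrier_mat n n" using Bc L by (simp add: K_def)
  have LK: "L * K = 1\<^sub>m n" using L Bc by (simp add: K_def assoc_mult_mat[of _ n n _ n _ n])
  have KL: "K * L = 1\<^sub>m n" using mat_mult_left_right_inverse[OF L(1) K LK] .
  have WB: "W * B = 1\<^sub>m n" using mat_mult_left_right_inverse[OF Bc W] .
  have "W * (K * L) = W * B * (transpose_mat L * L)"
    using W(1) Bc L(1) by (simp add: K_def assoc_mult_mat[of _ n n _ n _ n])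
  then have "W = transpose_mat L * L"
    using W(1) L(1) by (simp add: KL WB)
  with L K LK KL show thesis using that by blast
qed

text \<open>Tangent inequality for the concave function \<open>ln det\<close> at \<open>B\<close>,
  whose gradient there is \<open>W\<close>. Congruence by \<open>L\<close> multiplies both
  determinants by the same factor and moves \<open>B\<close> to the identity, leaving an estimate
  for the single matrix \<open>C\<close>.\<close>

lemma ln_det_concave:
  assumes A: "pos_def_mat n A" and B: "pos_def_mat n B"
    and W: "W \<in> carrier_mat n n" "B * W = 1\<^sub>m n"
  shows "ln (det A) - ln (det B) \<le> (\<Sum>i<n. \<Sum>j<n. W $$ (i, j) * A $$ (i, j)) - real n"
proof -
  obtain L K where L: "L \<in> carrier_mat n n" and K: "K \<in> carrier_mat n n" "L * K = 1\<^sub>m n"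
    and LB: "L * B * transpose_mat L = 1\<^sub>m n" and WL: "W = transpose_mat L * L"
    using pos_def_inverse_factor[OF B W] by metis
  have Ac: "A \<in> carrier_mat n n" and Bc: "B \<in> carrier_mat n n"
    using A B by (simp_all add: pos_def_mat_def)
  define C where "C = L * A * transpose_mat L"
  have C: "pos_def_mat n C" unfolding C_def by (rule pos_def_congruence[OF A L K])
  have "(det L)\<^sup>2 * det B = det (L * B * transpose_mat L)"
    using L Bc by (simp add: det_mult[of _ n] det_transpose[of _ n] power2_eq_square)
  then have detB: "(det L)\<^sup>2 * det B = 1" by (simp add: LB)
  have detC: "det C = (det L)\<^sup>2 * det A"
    using L Ac by (simp add: C_def det_mult[of _ n] det_transpose[of _ n] power2_eq_square)
  have posd: "0 < det A" "0 < det B" "0 < det C"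
    using hadamard_inequality(1) A B C by auto
  have "(det L)\<^sup>2 = 1 / det B" using detB posd by (simp add: field_simps)
  then have "ln (det A) - ln (det B) = ln (det C)"
    using posd by (simp add: detC ln_div)
  also have "\<dots> \<le> (\<Sum>k<n. C $$ (k, k)) - real n"
  proof -
    \<comment> \<open>Hadamard's inequality followed by \<open>c \<le> exp (c - 1)\<close> on the diagonal\<close>
    have "det C \<le> (\<Prod>k<n. C $$ (k, k))" by (rule hadamard_inequality(2)[OF C])
    also have "\<dots> \<le> (\<Prod>k<n. exp (C $$ (k, k) - 1))"
    proof (intro prod_mono conjI)
      fix k assume k: "k \<in> {..<n}"
      then show "0 \<le> C $$ (k, k)" using pos_def_diag_pos[OF C, of k] by simp
      show "C $$ (k, k) \<le> exp (C $$ (k, k) - 1)"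
        using exp_ge_add_one_self[of "C $$ (k, k) - 1"] by simp
    qed
    also have "\<dots> = exp ((\<Sum>k<n. C $$ (k, k)) - real n)"
      by (simp add: exp_sum[symmetric] sum_subtractf)
    finally have "ln (det C) \<le> ln (exp ((\<Sum>k<n. C $$ (k, k)) - real n))"
      using posd by (subst ln_le_cancel_iff) simp_all
    then show ?thesis by simp
  qed
  \<comment> \<open>Cyclicity of the trace in coordinates: moving \<open>L\<close> to the other side
    of \<open>A\<close> produces \<open>W\<close>.\<close>
  also have "(\<Sum>k<n. C $$ (k, k)) = (\<Sum>k<n. \<Sum>i<n. \<Sum>j<n. L $$ (k, i) * A $$ (i, j) * L $$ (k, j))"
    unfolding C_def using index_congruence[OF L Ac] by (intro sum.cong) (auto simp: bilin_def)
  also have "\<dots> = (\<Sum>i<n. \<Sum>j<n. \<Sum>k<n. L $$ (k, i) * A $$ (i, j) * L $$ (k, j))"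
    by (subst sum.swap, rule sum.cong[OF refl], rule sum.swap)
  also have "\<dots> = (\<Sum>i<n. \<Sum>j<n. W $$ (i, j) * A $$ (i, j))"
    using L by (auto simp: WL scalar_prod_def atLeast0LessThan sum_distrib_left mult_ac intro!: sum.cong)
  finally show ?thesis .
qed

text \<open>Cauchy--Schwarz for the factorisation \<open>B = K K\<^sup>T\<close>, \<open>W = L\<^sup>T L\<close>, \<open>L K = 1\<close>.\<close>

lemma bilin_inverse_ge:
  assumes B: "pos_def_mat n B" and W: "W \<in> carrier_mat n n" "B * W = 1\<^sub>m n" and "m < n"
  shows "0 < B $$ (m, m)" "(u m)\<^sup>2 \<le> B $$ (m, m) * bilin n W u u"
proof -
  show "0 < B $$ (m, m)" by (rule pos_def_diag_pos[OF B \<open>m < n\<close>])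
  obtain L K where L: "L \<in> carrier_mat n n" and K: "K \<in> carrier_mat n n" "K * L = 1\<^sub>m n"
    and LB: "L * B * transpose_mat L = 1\<^sub>m n" and WL: "W = transpose_mat L * L"
    using pos_def_inverse_factor[OF B W] by metis
  have Bc: "B \<in> carrier_mat n n" using B by (simp add: pos_def_mat_def)
  \<comment> \<open>\<open>y\<close> is \<open>L\<close> applied to \<open>u\<close>: its squared
    norm is the form of \<open>W\<close> at \<open>u\<close>, and row \<open>m\<close> of
    \<open>K\<close> paired with it returns \<open>u m\<close>.\<close>
  define y where "y k = (\<Sum>i<n. L $$ (k, i) * u i)" for k
  have "(\<Sum>k<n. (y k)\<^sup>2) = (\<Sum>k<n. \<Sum>i<n. \<Sum>j<n. u i * (L $$ (k, i) * L $$ (k, j)) * u j)"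
    by (simp add: y_def power2_eq_square sum_product mult_ac)
  also have "\<dots> = (\<Sum>i<n. \<Sum>j<n. \<Sum>k<n. u i * (L $$ (k, i) * L $$ (k, j)) * u j)"
    by (subst sum.swap, rule sum.cong[OF refl], rule sum.swap)
  also have "\<dots> = bilin n W u u"
    using L by (auto simp: bilin_def WL scalar_prod_def atLeast0LessThan sum_distrib_right
        sum_distrib_left mult.assoc intro!: sum.cong)
  finally have norm_y: "(\<Sum>k<n. (y k)\<^sup>2) = bilin n W u u" .
  have "(\<Sum>k<n. K $$ (m, k) * y k) = (\<Sum>k<n. \<Sum>i<n. K $$ (m, k) * L $$ (k, i) * u i)"
    by (simp add: y_def sum_distrib_left mult.assoc)
  also have "\<dots> = (\<Sum>i<n. (K * L) $$ (m, i) * u i)"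
    using K(1) L \<open>m < n\<close>
    by (subst sum.swap) (auto simp: scalar_prod_def atLeast0LessThan sum_distrib_right intro!: sum.cong)
  also have "\<dots> = (\<Sum>i<n. if i = m then u i else 0)"
    using \<open>m < n\<close> unfolding K(2) by (intro sum.cong) simp_all
  also have "\<dots> = u m" using \<open>m < n\<close> by simp
  finally have um: "(\<Sum>k<n. K $$ (m, k) * y k) = u m" .
  have KKT: "B = K * transpose_mat K"
  proof -
    have "L * (B * transpose_mat L) = 1\<^sub>m n"
      using LB L Bc by (simp add: assoc_mult_mat[of _ n n _ n _ n])
    then have "K * (L * (B * transpose_mat L)) = K" using K by simp
    moreover have "K * (L * (B * transpose_mat L)) = K * L * (B * transpose_mat L)"
      using K(1) L Bc by (intro assoc_mult_mat[symmetric]) auto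
    ultimately have BLT: "B * transpose_mat L = K" using K(2) L Bc by simp
    have "transpose_mat (K * L) = 1\<^sub>m n" using K(2) by simp
    then have "transpose_mat L * transpose_mat K = 1\<^sub>m n"
      using K(1) L by (simp add: transpose_mult[of _ n n])
    then have "B * (transpose_mat L * transpose_mat K) = B" using Bc by simp
    moreover have "B * (transpose_mat L * transpose_mat K) = B * transpose_mat L * transpose_mat K"
      using Bc L K(1) by (intro assoc_mult_mat[symmetric]) auto
    ultimately show ?thesis by (simp add: BLT)
  qed
  have "(\<Sum>k<n. (K $$ (m, k))\<^sup>2) = B $$ (m, m)"
    using K(1) \<open>m < n\<close> by (simp add: KKT scalar_prod_def atLeast0LessThan power2_eq_square)
  then show "(u m)\<^sup>2 \<le> B $$ (m, m) * bilin n W u u"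
    using Cauchy_Schwarz_ineq_sum[of "\<lambda>k. K $$ (m, k)" y "{..<n}"] by (simp add: um norm_y)
qed

section \<open>Negativity sets of real polynomials\<close>

text \<open>The negativity set is peeled from the right, one component at a time. Each component
  uses up two roots, so there are at most \<open>n\<close>; the bound \<open>B\<close> makes all end
  points finite. Neighbouring components may share an end point, which the weak inequalities in
  \<open>ordered_settings\<close> allow.\<close>

lemma poly_negative_set:
  fixes p :: "real poly"
  assumes "degree p \<le> 2 * n" and "{x. poly p x < 0} \<noteq> {}"
    and "\<forall>x. poly p x < 0 \<longrightarrow> \<bar>x\<bar> \<le> B"
  shows "\<exists>r a. 1 \<le> r \<and> r \<le> n \<and> ordered_settings a r \<and>
    {x. poly p x < 0} = (\<Union>k\<in>{1..r}. {a (2 * k)<..<a (2 * k - 1)})"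
  using assms
proof (induction n arbitrary: p)
  case 0
  then obtain c where c: "p = [:c:]" using degree_eq_zeroE by auto
  then have "c < 0" using "0.prems"(2) by (simp split: if_splits)
  then show ?case using "0.prems"(3)[rule_format, of "\<bar>B\<bar> + 1"] by (simp add: c)
next
  case (Suc n)
  define S where "S = {x. poly p x < 0}"
  have S: "S \<noteq> {}" "\<And>x. x \<in> S \<Longrightarrow> \<bar>x\<bar> \<le> B" "p \<noteq> 0"
    using Suc.prems by (auto simp: S_def)
  have bdd: "bdd_above S"
    by (rule bdd_aboveI[of _ B]) (use S(2) in force)
  have openS: "open S" unfolding S_def by (intro open_Collect_less continuous_intros)
  define b where "b = Sup S"
  have le_b: "x \<le> b" if "x \<in> S" for x
    unfolding b_def using that bdd by (rule cSup_upper)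
  have "b \<notin> S"
  proof
    assume "b \<in> S"
    then obtain e where "e > 0" "ball b e \<subseteq> S" using openS open_contains_ball by blast
    then have "b + e / 2 \<in> S" by (auto simp: dist_real_def subset_iff)
    then show False using le_b \<open>e > 0\<close> by force
  qed
  moreover have "b \<in> {x. poly p x \<le> 0}"
    unfolding b_def
    by (rule closed_subset_contains_Sup)
      (use S(1) bdd in \<open>auto simp: S_def intro!: closed_Collect_le continuous_intros\<close>)
  ultimately have pb: "poly p b = 0" by (simp add: S_def)
  have lt_b: "x < b" if "x \<in> S" for x
    using le_b[OF that] that \<open>b \<notin> S\<close> by (cases "x = b") auto
  define R where "R = {x. x < b \<and> poly p x = 0}"
  have finR: "finite R"
    using poly_roots_finite[OF S(3)] by (rule rev_finite_subset) (auto simp: R_def)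
  have "R \<noteq> {}"
  proof -
    obtain x where x: "x \<in> S" using S(1) by blast
    \<comment> \<open>A point beyond the bound and to the left of \<open>S\<close>; \<open>p\<close>
      is nonnegative there and negative at \<open>x\<close>, so a root lies in between.\<close>
    define y where "y = - \<bar>B\<bar> - 1"
    have "y \<notin> S" using S(2)[of y] by (auto simp: y_def)
    moreover have "y < x" using S(2)[OF x] by (auto simp: y_def)
    ultimately have "y \<in> R \<or> (\<exists>z. y < z \<and> z < x \<and> poly p z = 0)"
      using poly_IVT_neg[of y x p] x lt_b[OF x] by (auto simp: S_def R_def not_less order_le_less)
    then have "\<exists>z\<le>x. poly p z = 0 \<and> z < b"
      using lt_b[OF x] \<open>y < x\<close> by (auto simp: R_def intro: less_imp_le order.strict_trans)
    then show ?thesis by (auto simp: R_def)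
  qed
  define c where "c = Max R"
  have "c \<in> R" unfolding c_def using finR \<open>R \<noteq> {}\<close> by (rule Max_in)
  then have c: "c < b" "poly p c = 0" by (auto simp: R_def)
  have no_root: "poly p x \<noteq> 0" if "c < x" "x < b" for x
  proof
    assume "poly p x = 0"
    then have "x \<le> c" unfolding c_def using finR that by (intro Max_ge) (auto simp: R_def)
    then show False using that by simp
  qed
  have neg: "poly p x < 0" if "c < x" "x < b" for x
  proof (rule ccontr)
    assume "\<not> poly p x < 0"
    then have px: "0 < poly p x" using no_root[OF that] by simp
    \<comment> \<open>\<open>S\<close> reaches beyond \<open>c\<close> because its supremum
      \<open>b\<close> does; a sign change between \<open>x\<close> and \<open>y\<close> would put a
      root strictly between \<open>c\<close> and \<open>b\<close>.\<close>
    obtain y where y: "y \<in> S" "c < y"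
      using less_cSupD[of S c] S(1) c(1) by (auto simp: b_def)
    then have py: "poly p y < 0" "y < b" using lt_b by (auto simp: S_def)
    show False
    proof (cases x y rule: linorder_cases)
      case less
      then obtain z where "x < z" "z < y" "poly p z = 0" using poly_IVT_neg px py by blast
      then show False using no_root[of z] that py by simp
    next
      case equal
      then show False using px py by simp
    next
      case greater
      then obtain z where "y < z" "z < x" "poly p z = 0" using poly_IVT_pos px py by blast
      then show False using no_root[of z] that y by simp
    qed
  qed
  \<comment> \<open>\<open>{c<..<b}\<close> is the rightmost component; dividing out its two end points removes it and lowers
    the degree by two. A point shared with the next component survives as a root of the quotient.\<close>
  obtain h where h: "p = [:- b, 1:] * h" using pb poly_eq_0_iff_dvd by (metis dvdE)
  have "poly h c = 0" using c by (simp add: h)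
  then obtain g where g: "h = [:- c, 1:] * g" using poly_eq_0_iff_dvd by (metis dvdE)
  have p_eq: "poly p x = (x - b) * (x - c) * poly g x" for x
    by (simp add: h g algebra_simps)
  have "g \<noteq> 0" "h \<noteq> 0" using S(3) by (auto simp: h g)
  then have "degree h = Suc (degree g)" "degree p = Suc (degree h)"
    using degree_mult_eq[of "[:- c, 1:]" g] degree_mult_eq[of "[:- b, 1:]" h]
    unfolding g[symmetric] h[symmetric] by simp_all
  then have deg: "degree g \<le> 2 * n" using Suc.prems(1) by simp
  have g_pos: "0 < poly g x" if "c < x" "x < b" for x
  proof -
    have "(x - b) * (x - c) < 0" using that by (simp add: mult_neg_pos)
    then show ?thesis
      using neg[OF that] mult_nonpos_nonpos[of "(x - b) * (x - c)" "poly g x"]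
      unfolding p_eq by linarith
  qed
  define m where "m = (b + c) / 2"
  have m: "c < m" "m < b" using c by (auto simp: m_def)
  \<comment> \<open>Inside the removed component \<open>g\<close> is positive, and beyond
    \<open>b\<close> it has the sign of \<open>p\<close>. At the two end points a negative value
    would force a root of \<open>g\<close> inside the component.\<close>
  have g_nonneg: "0 \<le> poly g x" if "c \<le> x" for x
  proof (rule ccontr)
    assume neg_g: "\<not> 0 \<le> poly g x"
    have "x = c \<or> c < x \<and> x < b \<or> x = b \<or> b < x" using that by linarith
    then consider "x = c" | "c < x" "x < b" | "x = b" | "b < x" by blast
    then show False
    proof cases
      case 1
      then obtain z where "c < z" "z < m" "poly g z = 0"
        using poly_IVT_pos[OF m(1), of g] g_pos[OF m] neg_g by auto
      then show False using g_pos[of z] m by simp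
    next
      case 2
      then show False using g_pos neg_g by force
    next
      case 3
      then obtain z where "m < z" "z < b" "poly g z = 0"
        using poly_IVT_neg[OF m(2), of g] g_pos[OF m] neg_g by auto
      then show False using g_pos[of z] m by simp
    next
      case 4
      then have "0 < (x - b) * (x - c)" using c by simp
      then have "poly p x < 0" using neg_g by (simp add: p_eq mult_pos_neg)
      then have "x \<in> S" by (simp add: S_def)
      from lt_b[OF this] 4 show False by simp
    qed
  qed
  have g_neg: "poly g x < 0 \<longleftrightarrow> x < c \<and> poly p x < 0" for x
  proof (cases "x < c")
    case True
    then have "0 < (x - b) * (x - c)" using c by (simp add: mult_neg_neg)
    then have "poly p x < 0 \<longleftrightarrow> poly g x < 0"
      using mult_less_cancel_left_pos[of "(x - b) * (x - c)" "poly g x" 0] unfolding p_eq by auto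
    then show ?thesis using True by simp
  next
    case False
    then show ?thesis using g_nonneg[of x] by simp
  qed
  have S_eq: "{x. poly p x < 0} = {c<..<b} \<union> {x. poly g x < 0}"
  proof (intro equalityI subsetI)
    fix x assume "x \<in> {x. poly p x < 0}"
    then have px: "poly p x < 0" "x < b" using lt_b by (simp_all add: S_def)
    then have "x \<noteq> c" using c(2) by auto
    then show "x \<in> {c<..<b} \<union> {x. poly g x < 0}"
      using px g_neg[of x] by (cases "x < c") auto
  next
    fix x assume "x \<in> {c<..<b} \<union> {x. poly g x < 0}"
    then have "c < x \<and> x < b \<or> poly g x < 0" by auto
    then show "x \<in> {x. poly p x < 0}" using neg[of x] g_neg[of x] by blast
  qed
  show ?case
  proof (cases "{x. poly g x < 0} = {}")
    case True
    define a where "a k = (if k = 1 then b else c)" for k :: nat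
    have a: "a 1 = b" "a 2 = c" by (simp_all add: a_def)
    have "{x. poly p x < 0} = (\<Union>k\<in>{1..1}. {a (2 * k)<..<a (2 * k - 1)})"
      using True by (simp add: S_eq a[simplified])
    moreover have "ordered_settings a 1"
      using c(1) by (simp add: ordered_settings_def a[simplified])
    ultimately show ?thesis by (intro exI[of _ 1] exI[of _ a]) simp
  next
    case False
    have bound: "\<forall>x. poly g x < 0 \<longrightarrow> \<bar>x\<bar> \<le> B"
      using Suc.prems(3) g_neg by simp
    obtain r a where ra: "1 \<le> r" "r \<le> n" "ordered_settings a r"
      and g_set: "{x. poly g x < 0} = (\<Union>k\<in>{1..r}. {a (2 * k)<..<a (2 * k - 1)})"
      using Suc.IH[OF deg False bound] by (elim exE conjE) (rule that)
    \<comment> \<open>The remaining components lie to the left of \<open>c\<close>; equality means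
      that the next one touches the removed one.\<close>
    have a_le: "a 1 \<le> c"
    proof (rule ccontr)
      assume a1: "\<not> a 1 \<le> c"
      have "a (2 * 1) < a (2 * 1 - 1)"
        using ra(1,3) unfolding ordered_settings_def by (meson atLeastAtMost_iff order_refl)
      then have a12: "a 2 < a 1" by simp
      define y where "y = (max c (a 2) + a 1) / 2"
      have y: "c < y" "a 2 < y" "y < a 1" using a1 a12 by (auto simp: y_def max_def)
      then have "y \<in> (\<Union>k\<in>{1..r}. {a (2 * k)<..<a (2 * k - 1)})"
        using ra(1) by (intro UN_I[of 1]) auto
      then have "poly g y < 0" using g_set by blast
      then show False using g_neg[of y] y by simp
    qed
    \<comment> \<open>The removed component goes in front, so the settings obtained for
      \<open>g\<close> move up by two places.\<close>
    define a' where "a' k = (if k = 1 then b else if k = 2 then c else a (k - 2))" for k :: nat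
    have a'_odd: "a' (2 * Suc k - 1) = a (2 * k - 1)" if "1 \<le> k" for k
    proof -
      have "2 * Suc k - 1 - 2 = 2 * k - 1" "2 * Suc k - 1 \<noteq> 1" "2 * Suc k - 1 \<noteq> 2"
        using that by presburger+
      then show ?thesis unfolding a'_def by (simp only: if_False)
    qed
    have a'_even: "a' (2 * Suc k) = a (2 * k)" if "1 \<le> k" for k
      using that by (simp add: a'_def)
    have a'_odd': "a' (2 * Suc k + 1) = a (2 * k + 1)" for k
      by (simp add: a'_def)
    have a'_1: "a' (2 * 1 - 1) = b" "a' (2 * 1) = c" by (simp_all add: a'_def)
    have split: "k = 1 \<or> (\<exists>l\<ge>1. k = Suc l)" if "1 \<le> k" for k
      using that by (cases k) auto
    have "a' (2 * k) < a' (2 * k - 1)" if "1 \<le> k" "k \<le> Suc r" for k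
    proof -
      consider "k = 1" | l where "1 \<le> l" "k = Suc l" using split \<open>1 \<le> k\<close> by blast
      then show ?thesis
      proof cases
        case 1
        then show ?thesis using c(1) a'_1 by metis
      next
        case 2
        moreover have "a (2 * l) < a (2 * l - 1)" using ra(3) 2 that by (simp add: ordered_settings_def)
        ultimately show ?thesis by (simp only: a'_odd a'_even)
      qed
    qed
    moreover have "a' (2 * k + 1) \<le> a' (2 * k)" if "1 \<le> k" "k < Suc r" for k
    proof -
      consider "k = 1" | l where "1 \<le> l" "k = Suc l" using split \<open>1 \<le> k\<close> by blast
      then show ?thesis
      proof cases
        case 1
        then show ?thesis using a_le by (simp add: a'_def)
      next
        case 2
        moreover have "a (2 * l + 1) \<le> a (2 * l)" using ra(3) 2 that by (simp add: ordered_settings_def)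
        ultimately show ?thesis by (simp only: a'_odd' a'_even)
      qed
    qed
    ultimately have "ordered_settings a' (Suc r)" by (simp add: ordered_settings_def)
    moreover have "{x. poly p x < 0} = (\<Union>k\<in>{1..Suc r}. {a' (2 * k)<..<a' (2 * k - 1)})"
    proof -
      have dom: "{1..Suc r} = insert 1 (Suc ` {1..r})"
        using ra(1) by (simp add: atLeastAtMost_insertL)
      have "(\<Union>k\<in>{1..r}. {a' (2 * Suc k)<..<a' (2 * Suc k - 1)}) = {x. poly g x < 0}"
        unfolding g_set by (intro SUP_cong refl) (simp only: a'_odd a'_even atLeastAtMost_iff)
      then show ?thesis unfolding dom S_eq by (simp only: UN_insert a'_1 UN_simps image_image)
    qed
    ultimately show ?thesis using ra(2)
      by (intro exI[of _ "Suc r"] exI[of _ a']) simp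
  qed
qed

text \<open>Since the settings decrease, support intervals and gaps alternate along the line. For
  the covering, a point outside all support intervals and all gaps would be pushed to the left past
  each of them in turn until it lands in the last gap.\<close>

lemma support_intervals_complement:
  assumes "ordered_settings a r" and "1 \<le> r"
  shows "(\<Union>k\<in>{0..r}. support_interval a r k) = - (\<Union>k\<in>{1..r}. {a (2 * k)<..<a (2 * k - 1)})"
proof -
  have gap: "a (2 * k) < a (2 * k - 1)" if "1 \<le> k" "k \<le> r" for k
    using assms that by (simp add: ordered_settings_def)
  have inner: "a (2 * k + 1) \<le> a (2 * k)" if "1 \<le> k" "k < r" for k
    using assms that by (simp add: ordered_settings_def)
  have step: "a (Suc i) \<le> a i" if "1 \<le> i" "i < 2 * r" for i
  proof (cases "even i")
    case True
    then obtain k where "i = 2 * k" by blast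
    then show ?thesis using inner[of k] that by simp
  next
    case False
    then obtain k where "i = 2 * k + 1" using oddE by blast
    then show ?thesis using gap[of "k + 1"] that by simp
  qed
  have mono: "a j \<le> a i" if "i \<le> j" "1 \<le> i" "j \<le> 2 * r" for i j
    using that
  proof (induction j rule: dec_induct)
    case (step j)
    then show ?case using \<open>\<And>i. 1 \<le> i \<Longrightarrow> i < 2 * r \<Longrightarrow> a (Suc i) \<le> a i\<close>[of j] by simp
  qed simp
  show ?thesis
  proof (intro equalityI subsetI)
    fix x assume "x \<in> (\<Union>k\<in>{0..r}. support_interval a r k)"
    then obtain k where k: "k \<le> r" "x \<in> support_interval a r k" by auto
    have "\<not> (a (2 * l) < x \<and> x < a (2 * l - 1))" if "1 \<le> l" "l \<le> r" for l
    proof -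
      consider "k = 0" | "k \<noteq> 0" "k < r" "l \<le> k" | "k \<noteq> 0" "k < r" "k < l" | "k = r" "k \<noteq> 0"
        using k(1) by linarith
      then show ?thesis
      proof cases
        case 1
        moreover have "a (2 * l - 1) \<le> a 1" using that by (intro mono) auto
        ultimately show ?thesis using k(2) by (auto simp: support_interval_def)
      next
        case 2
        then show ?thesis using k(2) mono[of "2 * l" "2 * k"] that by (auto simp: support_interval_def)
      next
        case 3
        moreover from this have "a (2 * l - 1) \<le> a (2 * k + 1)" using that by (intro mono) auto
        ultimately show ?thesis using k(2) by (auto simp: support_interval_def)
      next
        case 4
        then show ?thesis using k(2) mono[of "2 * l" "2 * r"] that by (auto simp: support_interval_def)
      qed
    qed
    then show "x \<in> - (\<Union>k\<in>{1..r}. {a (2 * k)<..<a (2 * k - 1)})" by auto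
  next
    fix x assume "x \<in> - (\<Union>k\<in>{1..r}. {a (2 * k)<..<a (2 * k - 1)})"
    then have no_gap: "\<not> (a (2 * k) < x \<and> x < a (2 * k - 1))" if "1 \<le> k" "k \<le> r" for k
      using that by auto
    show "x \<in> (\<Union>k\<in>{0..r}. support_interval a r k)"
    proof (rule ccontr)
      assume "x \<notin> (\<Union>k\<in>{0..r}. support_interval a r k)"
      then have out: "x \<notin> support_interval a r k" if "k \<le> r" for k using that by auto
      have lt: "x < a (2 * k + 1)" if "k < r" for k
        using that
      proof (induction k)
        case 0
        then show ?case using out[of 0] by (simp add: support_interval_def)
      next
        case (Suc k)
        then have "x \<le> a (2 * Suc k)" using no_gap[of "Suc k"] by simp
        then show ?case using out[of "Suc k"] Suc.prems by (simp add: support_interval_def)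
      qed
      have "x < a (2 * (r - 1) + 1)" using assms(2) by (intro lt) simp
      also have "2 * (r - 1) + 1 = 2 * r - 1" using assms(2) by simp
      finally have "x < a (2 * r - 1)" .
      moreover have "a (2 * r) < x"
        using out[of r] assms(2) by (simp add: support_interval_def)
      ultimately show False using no_gap[of r] assms(2) by simp
    qed
  qed
qed

section \<open>Limits and thresholds\<close>

text \<open>By the Leibniz formula the determinant is a polynomial in the entries.\<close>

lemma tendsto_det:
  assumes "\<And>t. A t \<in> carrier_mat n n" "B \<in> carrier_mat n n"
    and "\<And>i j. i < n \<Longrightarrow> j < n \<Longrightarrow> ((\<lambda>t. A t $$ (i, j)) \<longlongrightarrow> (B $$ (i, j) :: real)) F"
  shows "((\<lambda>t. det (A t)) \<longlongrightarrow> det B) F"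
  unfolding det_def'[OF assms(1)] det_def'[OF assms(2)]
  by (intro tendsto_intros assms(3)) (auto simp: permutes_in_image[where S = "{0..<n}", simplified atLeastLessThan_iff])

text \<open>The entries of the adjugate are signed minors, so limits pass through it without any
  division; it stands in for the inverse in the first-order condition.\<close>

lemma tendsto_adj_mat:
  assumes A: "\<And>t. A t \<in> carrier_mat n n" and B: "B \<in> carrier_mat n n"
    and lim: "\<And>i j. i < n \<Longrightarrow> j < n \<Longrightarrow> ((\<lambda>t. A t $$ (i, j)) \<longlongrightarrow> (B $$ (i, j) :: real)) F"
    and "i < n" "j < n"
  shows "((\<lambda>t. adj_mat (A t) $$ (i, j)) \<longlongrightarrow> adj_mat B $$ (i, j)) F"
proof -
  have dims: "dim_row (A t) = n" "dim_col (A t) = n" "dim_row B = n" "dim_col B = n" for t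
    using A[of t] B by auto
  have "((\<lambda>t. det (mat_delete (A t) j i)) \<longlongrightarrow> det (mat_delete B j i)) F"
  proof (rule tendsto_det[of _ "n - 1"])
    show "mat_delete (A t) j i \<in> carrier_mat (n - 1) (n - 1)" for t
      using mat_delete_carrier[OF A] .
    show "mat_delete B j i \<in> carrier_mat (n - 1) (n - 1)"
      using mat_delete_carrier[OF B] .
    fix k l assume "k < n - 1" "l < n - 1"
    then show "((\<lambda>t. mat_delete (A t) j i $$ (k, l)) \<longlongrightarrow> mat_delete B j i $$ (k, l)) F"
      by (auto simp: mat_delete_def dims intro!: lim)
  qed
  then show ?thesis using assms(4,5)
    by (auto simp: adj_mat_def cofactor_def dims intro!: tendsto_intros)
qed

lemma AE_lborel_finite: "finite S \<Longrightarrow> AE x in lborel. x \<notin> (S :: real set)"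
  by (rule AE_I[of _ _ S]) (auto intro: finite_imp_null_set_lborel[THEN null_setsD1] borel_closed finite_imp_closed)

text \<open>The mass \<open>G s\<close> on which \<open>\<psi>\<close> is at least \<open>s\<close>
  equals 1 at \<open>s = 0\<close> and tends to 0. It is continuous because finite level sets are
  null, so it attains \<open>\<alpha>\<close> by the intermediate value theorem.\<close>

lemma threshold_exists:
  fixes \<psi> fX :: "real \<Rightarrow> real"
  assumes [measurable]: "\<psi> \<in> borel_measurable borel" "fX \<in> borel_measurable borel"
    and nonneg: "\<And>x. 0 \<le> fX x" and int: "integrable lborel fX" "(LINT x|lborel. fX x) = 1"
    and psi0: "\<And>x. 0 \<le> \<psi> x" and level: "\<And>s. finite {x. \<psi> x = s}"
    and alpha: "0 < \<alpha>" "\<alpha> < 1"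
  shows "\<exists>s. (LINT x|lborel. (if s \<le> \<psi> x then fX x else 0)) = \<alpha>"
proof -
  define G where "G s = (LINT x|lborel. (if s \<le> \<psi> x then fX x else 0))" for s
  have G_cont: "isCont G s" for s
    unfolding continuous_at_sequentially o_def
  proof (intro allI impI)
    fix u assume u: "u \<longlonglongrightarrow> s"
    show "(\<lambda>n. G (u n)) \<longlonglongrightarrow> G s"
      unfolding G_def
    proof (rule integral_dominated_convergence[where w = fX])
      show "AE x in lborel. (\<lambda>n. if u n \<le> \<psi> x then fX x else 0) \<longlonglongrightarrow> (if s \<le> \<psi> x then fX x else 0)"
        using AE_lborel_finite[OF level[of s]]
      proof eventually_elim
        case (elim x)
        then consider "s < \<psi> x" | "\<psi> x < s" by (auto simp: neq_iff)
        then show ?case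
        proof cases
          case 1
          then have "\<forall>\<^sub>F n in sequentially. u n < \<psi> x" using u by (rule order_tendstoD(2)[rotated])
          then have "\<forall>\<^sub>F n in sequentially. (if u n \<le> \<psi> x then fX x else 0) = fX x"
            by eventually_elim simp
          then show ?thesis using 1 by (auto intro: tendsto_eventually)
        next
          case 2
          then have "\<forall>\<^sub>F n in sequentially. \<psi> x < u n" using u by (rule order_tendstoD(1)[rotated])
          then have "\<forall>\<^sub>F n in sequentially. (if u n \<le> \<psi> x then fX x else 0) = 0"
            by eventually_elim simp
          then show ?thesis using 2 by (auto intro: tendsto_eventually)
        qed
      qed
    qed (use int nonneg in auto)
  qed
  have "(\<lambda>n. G (real n)) \<longlonglongrightarrow> (LINT x::real|lborel. 0)"
    unfolding G_def
  proof (rule integral_dominated_convergence[where w = fX])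
    show "AE x in lborel. (\<lambda>n. if real n \<le> \<psi> x then fX x else 0) \<longlonglongrightarrow> 0"
    proof (rule AE_I2)
      fix x
      have "\<forall>\<^sub>F n in sequentially. \<psi> x < real n"
        using filterlim_real_sequentially by (auto simp: filterlim_at_top_dense)
      then have "\<forall>\<^sub>F n in sequentially. (if real n \<le> \<psi> x then fX x else 0) = 0"
        by eventually_elim simp
      then show "(\<lambda>n. if real n \<le> \<psi> x then fX x else 0) \<longlonglongrightarrow> 0" by (rule tendsto_eventually)
    qed
  qed (use int nonneg in auto)
  then have "(\<lambda>n. G (real n)) \<longlonglongrightarrow> 0" by simp
  then have "\<forall>\<^sub>F n in sequentially. G (real n) < \<alpha>" using alpha(1) by (rule order_tendstoD(2))
  then obtain n where n: "G (real n) < \<alpha>" by (auto simp: eventually_sequentially)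
  have "G 0 = 1" using int psi0 by (simp add: G_def)
  then have "\<exists>s\<ge>0. s \<le> real n \<and> G s = \<alpha>"
    using n alpha G_cont by (intro IVT2) auto
  then show ?thesis by (auto simp: G_def)
qed

section \<open>Optimal subsampling densities\<close>

locale covariate =
  fixes q :: nat and \<alpha> :: real and fX :: "real \<Rightarrow> real"
  assumes q: "1 \<le> q" and alpha: "0 < \<alpha>" "\<alpha> < 1"
    and fX_borel [measurable]: "fX \<in> borel_measurable borel"
    and fX_nonneg: "\<And>x. 0 \<le> fX x"
    and fX_prob: "has_bochner_integral lborel fX 1"
    and fX_moment: "integrable lborel (\<lambda>x. \<bar>x\<bar> ^ (2 * q) * fX x)"
begin

section \<open>Designs through their densities and moment matrices\<close>

definition design_density :: "(real \<Rightarrow> real) \<Rightarrow> bool" where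
  "design_density f \<longleftrightarrow> f \<in> borel_measurable borel \<and> (\<forall>x. 0 \<le> f x \<and> f x \<le> fX x) \<and>
     integrable lborel f \<and> (LINT x|lborel. f x) = \<alpha>"

definition moment_mat :: "(real \<Rightarrow> real) \<Rightarrow> real mat" where
  "moment_mat f = mat (q + 1) (q + 1) (\<lambda>(i, j). LINT x|lborel. x ^ i * x ^ j * f x)"

text \<open>With \<open>W\<close> the inverse of the moment matrix, this is the sensitivity function
  up to the factor \<open>\<alpha>\<close>.\<close>

definition quad :: "real mat \<Rightarrow> real \<Rightarrow> real" where
  "quad W x = bilin (q + 1) W (\<lambda>i. x ^ i) (\<lambda>i. x ^ i)"

lemma subsampling_design_iff:
  "subsampling_design fX \<alpha> \<eta> \<longleftrightarrow> (\<exists>f. design_density f \<and> \<eta> = density lborel (\<lambda>x. ennreal (f x)))"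
  by (auto simp: subsampling_design_def design_density_def has_bochner_integral_iff)

lemma design_densityD [measurable_dest]:
  "design_density f \<Longrightarrow> f \<in> borel_measurable borel"
  by (simp add: design_density_def)

lemma info_matrix_density:
  assumes "design_density f"
  shows "info_matrix q (density lborel (\<lambda>x. ennreal (f x))) = moment_mat f"
proof -
  have f [measurable]: "f \<in> borel_measurable borel" "\<And>x. 0 \<le> f x"
    using assms by (auto simp: design_density_def)
  show ?thesis
    unfolding info_matrix_def moment_mat_def
  proof (rule cong_mat, goal_cases)
    case (3 i j)
    have "(LINT x|density lborel (\<lambda>x. ennreal (f x)). x ^ i * x ^ j) =
        (LINT x|lborel. f x *\<^sub>R (x ^ i * x ^ j))"
      by (rule integral_density) (use f in auto)
    then show ?case using 3 by (simp add: regression_vec_def mult_ac)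
  qed auto
qed

text \<open>Powers of \<open>x\<close> of order at most \<open>2 * q\<close> are dominated by
  \<open>1 + \<bar>x\<bar> ^ (2 * q)\<close>, which is integrable against \<open>fX\<close>.\<close>

lemma integrable_moment:
  assumes f: "design_density f" and "i \<le> q" "j \<le> q"
  shows "integrable lborel (\<lambda>x. x ^ i * x ^ j * f x)"
proof (rule Bochner_Integration.integrable_bound)
  show "integrable lborel (\<lambda>x. fX x + \<bar>x\<bar> ^ (2 * q) * fX x)"
    using fX_prob fX_moment by (auto simp: has_bochner_integral_iff)
  show "(\<lambda>x. x ^ i * x ^ j * f x) \<in> borel_measurable lborel"
    using f by measurable
  show "AE x in lborel. norm (x ^ i * x ^ j * f x) \<le> norm (fX x + \<bar>x\<bar> ^ (2 * q) * fX x)"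
  proof (rule AE_I2)
    fix x :: real
    have b: "\<bar>x\<bar> ^ (i + j) \<le> 1 + \<bar>x\<bar> ^ (2 * q)"
    proof (cases "\<bar>x\<bar> \<le> 1")
      case True
      then have "\<bar>x\<bar> ^ (i + j) \<le> 1" by (simp add: power_le_one)
      then show ?thesis by (simp add: add_increasing2)
    next
      case False
      then have "\<bar>x\<bar> ^ (i + j) \<le> \<bar>x\<bar> ^ (2 * q)" using assms by (intro power_increasing) auto
      then show ?thesis by simp
    qed
    have "norm (x ^ i * x ^ j * f x) = \<bar>x\<bar> ^ (i + j) * f x"
      using f by (simp add: design_density_def abs_mult power_abs power_add)
    also have "\<dots> \<le> (1 + \<bar>x\<bar> ^ (2 * q)) * fX x"
      using f b by (intro mult_mono) (auto simp: design_density_def)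
    also have "\<dots> \<le> norm (fX x + \<bar>x\<bar> ^ (2 * q) * fX x)" by (simp add: algebra_simps)
    finally show "norm (x ^ i * x ^ j * f x) \<le> norm (fX x + \<bar>x\<bar> ^ (2 * q) * fX x)" .
  qed
qed

text \<open>The bridge between integrals and matrices: integrating a quadratic form against
  \<open>f\<close> pairs its matrix entrywise with the moment matrix.\<close>

lemma has_integral_quad:
  assumes f: "design_density f"
  shows "has_bochner_integral lborel (\<lambda>x. quad W x * f x)
    (\<Sum>i<q+1. \<Sum>j<q+1. W $$ (i, j) * moment_mat f $$ (i, j))"
proof -
  have "has_bochner_integral lborel (\<lambda>x. \<Sum>i<q+1. \<Sum>j<q+1. W $$ (i, j) * (x ^ i * x ^ j * f x))
    (\<Sum>i<q+1. \<Sum>j<q+1. W $$ (i, j) * (LINT x|lborel. x ^ i * x ^ j * f x))"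
    by (intro has_bochner_integral_sum has_bochner_integral_mult_right has_bochner_integral_integrable
        integrable_moment[OF f]) auto
  also have "(\<lambda>x. \<Sum>i<q+1. \<Sum>j<q+1. W $$ (i, j) * (x ^ i * x ^ j * f x)) = (\<lambda>x. quad W x * f x)"
    by (simp add: quad_def bilin_def sum_distrib_right sum_distrib_left mult_ac del: sum.lessThan_Suc)
  also have "(\<Sum>i<q+1. \<Sum>j<q+1. W $$ (i, j) * (LINT x|lborel. x ^ i * x ^ j * f x)) =
      (\<Sum>i<q+1. \<Sum>j<q+1. W $$ (i, j) * moment_mat f $$ (i, j))"
    by (intro sum.cong) (auto simp: moment_mat_def)
  finally show ?thesis .
qed

lemma quad_poly:
  obtains p where "degree p \<le> 2 * q" "\<And>x. poly p x = quad W x"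
proof
  let ?p = "\<Sum>i<q+1. \<Sum>j<q+1. monom (W $$ (i, j)) (i + j)"
  show "degree ?p \<le> 2 * q"
    by (intro degree_sum_le) (auto intro!: order.trans[OF degree_monom_le])
  show "poly ?p x = quad W x" for x
    by (simp add: quad_def bilin_def poly_sum poly_monom power_add mult_ac del: sum.lessThan_Suc)
qed

text \<open>The form at \<open>v\<close> is the integral of the squared polynomial with coefficients
  \<open>v\<close> against \<open>f\<close>. If it were zero, \<open>f\<close> would vanish off the
  finitely many roots, contradicting its mass \<open>\<alpha> > 0\<close>.\<close>

lemma pos_def_moment_mat:
  assumes f: "design_density f"
  shows "pos_def_mat (q + 1) (moment_mat f)"
  unfolding pos_def_mat_def
proof (intro conjI allI impI)
  show "moment_mat f \<in> carrier_mat (q + 1) (q + 1)" by (simp add: moment_mat_def)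
  show "moment_mat f $$ (i, j) = moment_mat f $$ (j, i)" if "i < q + 1" "j < q + 1" for i j
    using that by (simp add: moment_mat_def mult_ac)
  fix v :: "nat \<Rightarrow> real" assume v: "\<exists>i<q+1. v i \<noteq> 0"
  \<comment> \<open>This rank-one matrix makes \<open>quad W\<close> the square of \<open>p\<close>,
    so that \<open>has_integral_quad\<close> evaluates the form.\<close>
  define W where "W = mat (q + 1) (q + 1) (\<lambda>(i, j). v i * v j)"
  define p where "p = (\<Sum>i<q+1. monom (v i) i)"
  have "coeff p i = v i" if "i < q + 1" for i
    using that by (simp add: p_def coeff_sum sum.delta del: sum.lessThan_Suc)
  then have "p \<noteq> 0" using v by auto
  have quad: "quad W x = (poly p x)\<^sup>2" for x
  proof -
    have "quad W x = (\<Sum>i<q+1. \<Sum>j<q+1. v i * x ^ i * (v j * x ^ j))"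
      unfolding quad_def bilin_def by (intro sum.cong) (auto simp: W_def)
    then show ?thesis
      by (simp add: p_def poly_sum poly_monom power2_eq_square sum_product del: sum.lessThan_Suc)
  qed
  have int: "has_bochner_integral lborel (\<lambda>x. (poly p x)\<^sup>2 * f x) (bilin (q + 1) (moment_mat f) v v)"
  proof -
    have "(\<Sum>i<q+1. \<Sum>j<q+1. W $$ (i, j) * moment_mat f $$ (i, j)) = bilin (q + 1) (moment_mat f) v v"
      unfolding bilin_def by (intro sum.cong) (auto simp: W_def)
    then show ?thesis using has_integral_quad[OF f, of W] by (simp add: quad del: sum.lessThan_Suc)
  qed
  have nn: "AE x in lborel. 0 \<le> (poly p x)\<^sup>2 * f x"
    using f by (simp add: design_density_def)
  have "bilin (q + 1) (moment_mat f) v v \<noteq> 0"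
  proof
    assume "bilin (q + 1) (moment_mat f) v v = 0"
    then have "integrable lborel (\<lambda>x. (poly p x)\<^sup>2 * f x)" "(LINT x|lborel. (poly p x)\<^sup>2 * f x) = 0"
      using int by (simp_all only: has_bochner_integral_iff)
    then have "AE x in lborel. (poly p x)\<^sup>2 * f x = 0"
      using iffD1[OF integral_nonneg_eq_0_iff_AE[OF _ nn]] by simp
    then have "AE x in lborel. f x = 0"
      using AE_lborel_finite[OF poly_roots_finite[OF \<open>p \<noteq> 0\<close>]] by eventually_elim auto
    then have "(LINT x|lborel. f x) = 0" using integral_cong_AE[of f lborel "\<lambda>_. 0"] f
      by (simp add: design_density_def)
    then show False using f alpha by (simp add: design_density_def)
  qed
  moreover have "0 \<le> bilin (q + 1) (moment_mat f) v v"
    using int integral_nonneg_AE[OF nn] by (simp add: has_bochner_integral_iff)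
  ultimately show "0 < bilin (q + 1) (moment_mat f) v v" by simp
qed

text \<open>Integral version of \<open>ln_det_concave\<close>. The dimension subtracted there is the
  integral of \<open>quad W\<close> against \<open>f\<close> itself, namely the trace of the
  identity.\<close>

lemma ln_det_moment_le:
  assumes f: "design_density f" and g: "design_density g"
    and W: "W \<in> carrier_mat (q + 1) (q + 1)" "moment_mat f * W = 1\<^sub>m (q + 1)"
  shows "ln (det (moment_mat g)) - ln (det (moment_mat f)) \<le>
    (LINT x|lborel. quad W x * g x) - (LINT x|lborel. quad W x * f x)"
proof -
  let ?n = "q + 1" and ?M = "moment_mat f"
  have M: "?M \<in> carrier_mat ?n ?n" by (simp add: moment_mat_def)
  have sym: "?M $$ (i, j) = ?M $$ (j, i)" if "i < ?n" "j < ?n" for i j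
    using that by (simp add: moment_mat_def mult_ac)
  have "(LINT x|lborel. quad W x * f x) = (\<Sum>i<?n. \<Sum>j<?n. W $$ (i, j) * ?M $$ (i, j))"
    using has_integral_quad[OF f, of W] by (simp add: has_bochner_integral_iff)
  also have "\<dots> = (\<Sum>i<?n. \<Sum>j<?n. W $$ (i, j) * ?M $$ (j, i))"
    by (intro sum.cong refl arg_cong2[where f = "(*)"] sym) auto
  also have "\<dots> = (\<Sum>i<?n. (W * ?M) $$ (i, i))"
    using W(1) M by (auto simp: scalar_prod_def atLeast0LessThan simp del: sum.lessThan_Suc intro!: sum.cong)
  also have "W * ?M = 1\<^sub>m ?n" by (rule mat_mult_left_right_inverse[OF M W])
  finally have "(LINT x|lborel. quad W x * f x) = real ?n" by simp
  moreover have "(LINT x|lborel. quad W x * g x) = (\<Sum>i<?n. \<Sum>j<?n. W $$ (i, j) * moment_mat g $$ (i, j))"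
    using has_integral_quad[OF g, of W] by (simp add: has_bochner_integral_iff)
  ultimately show ?thesis
    using ln_det_concave[OF pos_def_moment_mat[OF g] pos_def_moment_mat[OF f] W] by linarith
qed

text \<open>Positive definiteness gives a nonzero determinant, so \<open>the\<close> in
  \<open>sensitivity\<close> meets a \<open>Some\<close> value.\<close>

lemma mat_inverse_moment:
  assumes "design_density f"
  shows "the (mat_inverse (moment_mat f)) \<in> carrier_mat (q + 1) (q + 1)"
    and "moment_mat f * the (mat_inverse (moment_mat f)) = 1\<^sub>m (q + 1)"
proof -
  let ?M = "moment_mat f"
  have M: "?M \<in> carrier_mat (q + 1) (q + 1)" by (simp add: moment_mat_def)
  have "det ?M \<noteq> 0"
    using hadamard_inequality(1)[OF pos_def_moment_mat[OF assms]] by simp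
  then have "mat_inverse ?M \<noteq> None"
    using det_non_zero_imp_unit[OF M, where b = "()"] mat_inverse(1)[OF M, where b = "()"] by blast
  then obtain W where "mat_inverse ?M = Some W" by blast
  then show "the (mat_inverse ?M) \<in> carrier_mat (q + 1) (q + 1)" "?M * the (mat_inverse ?M) = 1\<^sub>m (q + 1)"
    using mat_inverse(2)[OF M] by auto
qed

section \<open>The sensitivity function as a polynomial\<close>

lemma sensitivity_quad:
  assumes "design_density f"
  shows "sensitivity q \<alpha> (density lborel (\<lambda>x. ennreal (f x))) x = \<alpha> * quad (the (mat_inverse (moment_mat f))) x"
  unfolding sensitivity_def info_matrix_density[OF assms] quad_def regression_vec_def
  by (simp only: bilin_scalar_prod[OF mat_inverse_moment(1)[OF assms]])

lemma sensitivity_poly: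
  assumes "design_density f"
  obtains p where "degree p \<le> 2 * q"
    "\<And>x. poly p x = sensitivity q \<alpha> (density lborel (\<lambda>x. ennreal (f x))) x"
proof -
  obtain p where p: "degree p \<le> 2 * q" "\<And>x. poly p x = quad (the (mat_inverse (moment_mat f))) x"
    using quad_poly by metis
  show thesis
    by (rule that[of "Polynomial.smult \<alpha> p"])
      (use p degree_smult_le[of \<alpha> p] in \<open>auto simp: sensitivity_quad[OF assms]\<close>)
qed

text \<open>Cauchy-Schwarz at index 1, where the regression vector has the entry \<open>x\<close>;
  the index exists because \<open>q\<close> is at least 1. This yields nonnegativity and growth on
  both sides without any leading coefficient.\<close>

lemma sensitivity_ge:
  assumes f: "design_density f"
  obtains c where "0 < c" "\<And>x. c * x\<^sup>2 \<le> sensitivity q \<alpha> (density lborel (\<lambda>x. ennreal (f x))) x"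
proof
  let ?M = "moment_mat f" and ?W = "the (mat_inverse (moment_mat f))"
  have "1 < q + 1" using q by simp
  note ge = bilin_inverse_ge[OF pos_def_moment_mat[OF f] mat_inverse_moment[OF f] this]
  show "0 < \<alpha> / ?M $$ (1, 1)" using ge(1) alpha by simp
  fix x
  have "x\<^sup>2 / ?M $$ (1, 1) \<le> quad ?W x"
    using ge(1) ge(2)[of "\<lambda>i. x ^ i"] by (simp add: quad_def field_simps)
  then have "\<alpha> * (x\<^sup>2 / ?M $$ (1, 1)) \<le> \<alpha> * quad ?W x"
    using alpha by (intro mult_left_mono) auto
  then show "\<alpha> / ?M $$ (1, 1) * x\<^sup>2 \<le> sensitivity q \<alpha> (density lborel (\<lambda>x. ennreal (f x))) x"
    by (simp add: sensitivity_quad[OF f])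
qed

lemma sensitivity_sublevel_bounded:
  assumes f: "design_density f"
  obtains B where "\<forall>x. sensitivity q \<alpha> (density lborel (\<lambda>x. ennreal (f x))) x < s \<longrightarrow> \<bar>x\<bar> \<le> B"
proof -
  obtain c where c: "0 < c"
    "\<And>x. c * x\<^sup>2 \<le> sensitivity q \<alpha> (density lborel (\<lambda>x. ennreal (f x))) x"
    using sensitivity_ge[OF f] by blast
  \<comment> \<open>The summand 1 ensures that a violating \<open>x\<close> has modulus at least 1,
    hence at most its square, so no square root is needed in the bound.\<close>
  have "\<bar>x\<bar> \<le> 1 + \<bar>s\<bar> / c" if "sensitivity q \<alpha> (density lborel (\<lambda>x. ennreal (f x))) x < s" for x
  proof (rule ccontr)
    assume "\<not> \<bar>x\<bar> \<le> 1 + \<bar>s\<bar> / c"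
    then have x: "1 + \<bar>s\<bar> / c < \<bar>x\<bar>" by simp
    moreover have "0 \<le> \<bar>s\<bar> / c" using c(1) by simp
    ultimately have "1 \<le> \<bar>x\<bar>" "\<bar>s\<bar> / c < \<bar>x\<bar>" by linarith+
    moreover from this have "\<bar>x\<bar> \<le> \<bar>x\<bar>\<^sup>2" by (intro self_le_power) auto
    ultimately have "\<bar>s\<bar> / c < x\<^sup>2" by simp
    then have "\<bar>s\<bar> < c * x\<^sup>2" using c(1) by (simp add: field_simps)
    then show False using c(2)[of x] that by simp
  qed
  then show thesis using that by blast
qed

text \<open>An infinite level set would make the polynomial constant, and then the sublevel set for
  \<open>s + 1\<close> would be the whole line instead of bounded.\<close>

lemma sensitivity_level_finite:
  assumes f: "design_density f"
  shows "finite {x. sensitivity q \<alpha> (density lborel (\<lambda>x. ennreal (f x))) x = s}"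
proof -
  obtain p where p: "degree p \<le> 2 * q"
    "\<And>x. poly p x = sensitivity q \<alpha> (density lborel (\<lambda>x. ennreal (f x))) x"
    using sensitivity_poly[OF f] by blast
  obtain B where B: "\<forall>x. sensitivity q \<alpha> (density lborel (\<lambda>x. ennreal (f x))) x < s + 1 \<longrightarrow> \<bar>x\<bar> \<le> B"
    using sensitivity_sublevel_bounded[OF f] by blast
  have "p - [:s:] \<noteq> 0"
  proof
    assume "p - [:s:] = 0"
    then have "p = [:s:]" by simp
    then have "poly p (\<bar>B\<bar> + 1) < s + 1" by simp
    then have "\<bar>\<bar>B\<bar> + 1\<bar> \<le> B" using B unfolding p(2) by blast
    then show False by simp
  qed
  from poly_roots_finite[OF this] show ?thesis by (simp add: p(2))
qed

lemma sensitivity_borel: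
  assumes f: "design_density f"
  shows "sensitivity q \<alpha> (density lborel (\<lambda>x. ennreal (f x))) \<in> borel_measurable borel"
proof -
  obtain p where "\<And>x. poly p x = sensitivity q \<alpha> (density lborel (\<lambda>x. ennreal (f x))) x"
    using sensitivity_poly[OF f] by metis
  then have "sensitivity q \<alpha> (density lborel (\<lambda>x. ennreal (f x))) = poly p" by auto
  moreover have "poly p \<in> borel_measurable borel"
    by (intro borel_measurable_continuous_onI continuous_on_poly continuous_on_id)
  ultimately show ?thesis by simp
qed

section \<open>Optimality conditions\<close>

text \<open>First-order necessary condition: the left side minus the right side is the directional
  derivative of \<open>ln det\<close> from \<open>f\<close> towards \<open>g\<close>, which cannot
  be positive at a maximum.\<close>

lemma optimal_directional:
  assumes f: "design_density f" and g: "design_density g"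
    and opt: "\<And>h. design_density h \<Longrightarrow> ln (det (moment_mat h)) \<le> ln (det (moment_mat f))"
    and W: "W \<in> carrier_mat (q + 1) (q + 1)" "moment_mat f * W = 1\<^sub>m (q + 1)"
  shows "(LINT x|lborel. quad W x * g x) \<le> (LINT x|lborel. quad W x * f x)"
proof -
  let ?n = "q + 1"
  \<comment> \<open>\<open>D\<close> is the direction of the move, \<open>A t\<close> the moment
    matrix of the mixture with weight \<open>t\<close> on \<open>g\<close>, and \<open>S V\<close>
    the pairing of \<open>V\<close> with the direction.\<close>
  define D where "D i j = moment_mat g $$ (i, j) - moment_mat f $$ (i, j)" for i j
  define A where "A t = mat ?n ?n (\<lambda>(i, j). moment_mat f $$ (i, j) + t * D i j)" for t
  define S where "S V = (\<Sum>i<?n. \<Sum>j<?n. V $$ (i, j) * D i j)" for V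
  have A: "A t \<in> carrier_mat ?n ?n" for t by (simp add: A_def)
  have M: "moment_mat f \<in> carrier_mat ?n ?n" by (simp add: moment_mat_def)
  have S_smult: "S (c \<cdot>\<^sub>m V) = c * S V" if "V \<in> carrier_mat ?n ?n" for c V
    unfolding S_def sum_distrib_left using that by (intro sum.cong refl) auto
  have S_diff: "S V = (LINT x|lborel. quad V x * g x) - (LINT x|lborel. quad V x * f x)" for V
    using has_integral_quad[OF f, of V] has_integral_quad[OF g, of V]
    unfolding S_def D_def has_bochner_integral_iff
    by (simp only: right_diff_distrib sum_subtractf)
  \<comment> \<open>The concavity inequality is applied at the mixture, so that optimality of \<open>f\<close> gives a sign
    for every \<open>t > 0\<close>; the adjugate, being polynomial in \<open>t\<close>, passes to the limit \<open>t = 0\<close>.\<close>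
  have neg: "S (adj_mat (A t)) \<le> 0" if t: "0 < t" "t < 1" for t
  proof -
    define h where "h x = (1 - t) * f x + t * g x" for x
    have h: "design_density h"
      unfolding design_density_def
    proof (intro conjI allI)
      show "h \<in> borel_measurable borel"
        using design_densityD[OF f] design_densityD[OF g] unfolding h_def by measurable
      show "0 \<le> h x" for x using f g t by (simp add: h_def design_density_def)
      show "h x \<le> fX x" for x
      proof -
        have "h x \<le> (1 - t) * fX x + t * fX x"
          unfolding h_def using f g t by (intro add_mono mult_left_mono) (auto simp: design_density_def)
        then show ?thesis by (simp add: algebra_simps)
      qed
      show "integrable lborel h" using f g by (simp add: h_def[abs_def] design_density_def)
      show "(LINT x|lborel. h x) = \<alpha>"
        using f g by (simp add: h_def design_density_def algebra_simps)
    qed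
    have Mh: "moment_mat h = A t"
    proof (rule eq_matI)
      fix i j assume "i < dim_row (A t)" "j < dim_col (A t)"
      then have ij: "i < ?n" "j < ?n" by (auto simp: A_def)
      have "(LINT x|lborel. x ^ i * x ^ j * h x) =
          (LINT x|lborel. (1 - t) * (x ^ i * x ^ j * f x) + t * (x ^ i * x ^ j * g x))"
        by (simp add: h_def algebra_simps)
      also have "\<dots> = (1 - t) * (LINT x|lborel. x ^ i * x ^ j * f x) + t * (LINT x|lborel. x ^ i * x ^ j * g x)"
        using integrable_moment[OF f, of i j] integrable_moment[OF g, of i j] ij by simp
      finally show "moment_mat h $$ (i, j) = A t $$ (i, j)"
        using ij by (simp add: A_def D_def moment_mat_def algebra_simps)
    qed (simp_all add: A_def moment_mat_def)
    have det: "0 < det (A t)" using hadamard_inequality(1)[OF pos_def_moment_mat[OF h]] by (simp add: Mh)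
    \<comment> \<open>The inverse of \<open>A t\<close> as adjugate over determinant; dropping the
      positive factor later leaves the sign of \<open>S\<close> unchanged.\<close>
    define V where "V = (1 / det (A t)) \<cdot>\<^sub>m adj_mat (A t)"
    have V: "V \<in> carrier_mat ?n ?n" using adj_mat(1)[OF A] by (simp add: V_def)
    have AV: "A t * V = 1\<^sub>m ?n"
    proof -
      have "A t * V = (1 / det (A t)) \<cdot>\<^sub>m (A t * adj_mat (A t))"
        unfolding V_def by (rule mult_smult_distrib[OF A adj_mat(1)[OF A]])
      also have "\<dots> = 1\<^sub>m ?n" unfolding adj_mat(2)[OF A] using det by (intro eq_matI) auto
      finally show ?thesis .
    qed
    have "0 \<le> ln (det (moment_mat f)) - ln (det (moment_mat h))" using opt[OF h] by simp
    also have "\<dots> \<le> (LINT x|lborel. quad V x * f x) - (LINT x|lborel. quad V x * h x)"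
      by (rule ln_det_moment_le[OF h f V]) (simp add: Mh AV)
    also have "(LINT x|lborel. quad V x * h x) =
        (LINT x|lborel. (1 - t) * (quad V x * f x) + t * (quad V x * g x))"
      by (simp add: h_def algebra_simps)
    also have "\<dots> = (1 - t) * (LINT x|lborel. quad V x * f x) + t * (LINT x|lborel. quad V x * g x)"
      using has_integral_quad[OF f, of V] has_integral_quad[OF g, of V]
      unfolding has_bochner_integral_iff by simp
    finally have "t * S V \<le> 0" by (simp add: S_diff algebra_simps)
    then have "S V \<le> 0" using t by (simp add: mult_le_0_iff)
    then show ?thesis using det adj_mat(1)[OF A] by (simp add: V_def S_smult divide_le_0_iff)
  qed
  have "((\<lambda>t. S (adj_mat (A t))) \<longlongrightarrow> S (adj_mat (moment_mat f))) (at_right 0)"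
    unfolding S_def
  proof (intro tendsto_sum tendsto_mult tendsto_const tendsto_adj_mat[OF A M])
    fix i j assume "i < ?n" "j < ?n"
    then have "(\<lambda>t. A t $$ (i, j)) = (\<lambda>t. moment_mat f $$ (i, j) + t * D i j)" by (auto simp: A_def)
    moreover have "((\<lambda>t. moment_mat f $$ (i, j) + t * D i j) \<longlongrightarrow> moment_mat f $$ (i, j) + 0 * D i j) (at_right 0)"
      by (intro tendsto_intros)
    ultimately show "((\<lambda>t. A t $$ (i, j)) \<longlongrightarrow> moment_mat f $$ (i, j)) (at_right 0)" by simp
  qed auto
  moreover have "\<forall>\<^sub>F t in at_right 0. S (adj_mat (A t)) \<le> 0"
    unfolding eventually_at_right_field using neg by (intro exI[of _ 1]) auto
  ultimately have "S (adj_mat (moment_mat f)) \<le> 0"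
    by (intro tendsto_upperbound[OF _ _ trivial_limit_at_right_real]) auto
  moreover have "adj_mat (moment_mat f) = det (moment_mat f) \<cdot>\<^sub>m W"
  proof -
    note adj = adj_mat[OF M]
    have "adj_mat (moment_mat f) * (moment_mat f * W) = adj_mat (moment_mat f) * moment_mat f * W"
      by (rule assoc_mult_mat[OF adj(1) M W(1), symmetric])
    then show ?thesis using adj(1) W by (simp add: adj(3) mult_smult_assoc_mat[of _ "q + 1" "q + 1" _ "q + 1"])
  qed
  moreover have "0 < det (moment_mat f)" by (rule hadamard_inequality(1)[OF pos_def_moment_mat[OF f]])
  ultimately have "S W \<le> 0" using W(1) by (simp add: S_smult mult_le_0_iff)
  then show ?thesis by (simp add: S_diff)
qed

text \<open>Both densities have mass \<open>\<alpha>\<close>, so shifting the integrand by a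
  constant threshold does not change the integral of the difference.\<close>

lemma threshold_integral:
  assumes f: "design_density f" and g: "design_density g"
  shows "has_bochner_integral lborel (\<lambda>x. (\<alpha> * quad W x - s) * (g x - f x))
    (\<alpha> * ((LINT x|lborel. quad W x * g x) - (LINT x|lborel. quad W x * f x)))"
proof -
  have "has_bochner_integral lborel (\<lambda>x. \<alpha> * (quad W x * g x - quad W x * f x) - s * (g x - f x))
      (\<alpha> * ((LINT x|lborel. quad W x * g x) - (LINT x|lborel. quad W x * f x)) - s * (\<alpha> - \<alpha>))"
    by (intro has_bochner_integral_diff has_bochner_integral_mult_right)
      (use f g has_integral_quad[OF f, of W] has_integral_quad[OF g, of W] in
        \<open>auto simp: has_bochner_integral_iff design_density_def\<close>)
  then show ?thesis by (simp add: algebra_simps)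
qed

text \<open>A Neyman-Pearson argument. The sensitivity on the right is that of \<open>f\<close>
  itself, so this is a fixed point condition on \<open>f\<close> and not an explicit formula for
  it.\<close>

lemma optimal_iff_threshold:
  assumes f: "design_density f"
  shows "(\<forall>g. design_density g \<longrightarrow> ln (det (moment_mat g)) \<le> ln (det (moment_mat f))) \<longleftrightarrow>
    (\<exists>s. AE x in lborel. f x = (if s \<le> sensitivity q \<alpha> (density lborel (\<lambda>x. ennreal (f x))) x then fX x else 0))"
proof -
  define W where "W = the (mat_inverse (moment_mat f))"
  note W = mat_inverse_moment[OF f, folded W_def]
  define \<psi> where "\<psi> = sensitivity q \<alpha> (density lborel (\<lambda>x. ennreal (f x)))"
  have psi: "\<psi> x = \<alpha> * quad W x" for x by (simp add: \<psi>_def W_def sensitivity_quad[OF f])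
  have [measurable]: "\<psi> \<in> borel_measurable borel" unfolding \<psi>_def by (rule sensitivity_borel[OF f])
  have level: "finite {x. \<psi> x = s}" for s unfolding \<psi>_def by (rule sensitivity_level_finite[OF f])
  have "(\<forall>g. design_density g \<longrightarrow> ln (det (moment_mat g)) \<le> ln (det (moment_mat f))) \<longleftrightarrow>
    (\<exists>s. AE x in lborel. f x = (if s \<le> \<psi> x then fX x else 0))"
  proof
    assume opt: "\<forall>g. design_density g \<longrightarrow> ln (det (moment_mat g)) \<le> ln (det (moment_mat f))"
    have "0 \<le> \<psi> x" for x
    proof -
      obtain c where "0 < c" "c * x\<^sup>2 \<le> \<psi> x" unfolding \<psi>_def using sensitivity_ge[OF f] by metis
      moreover from this have "0 \<le> c * x\<^sup>2" by simp
      ultimately show ?thesis by linarith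
    qed
    then obtain s where s: "(LINT x|lborel. (if s \<le> \<psi> x then fX x else 0)) = \<alpha>"
      using threshold_exists[of \<psi> fX \<alpha>] fX_nonneg fX_prob level alpha
      by (auto simp: has_bochner_integral_iff)
    \<comment> \<open>The competitor to which the first-order condition is applied; it fills
      \<open>fX\<close> exactly where the sensitivity reaches the threshold.\<close>
    define g where "g x = (if s \<le> \<psi> x then fX x else 0)" for x
    have g: "design_density g"
      unfolding design_density_def
    proof (intro conjI allI)
      show gb: "g \<in> borel_measurable borel" unfolding g_def by measurable
      show "0 \<le> g x" "g x \<le> fX x" for x using fX_nonneg by (auto simp: g_def)
      show "integrable lborel g"
        by (rule Bochner_Integration.integrable_bound[of lborel fX])
          (use fX_prob gb fX_nonneg in \<open>auto simp: has_bochner_integral_iff g_def\<close>)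
      show "(LINT x|lborel. g x) = \<alpha>" using s by (simp add: g_def)
    qed
    let ?d = "\<lambda>x. (\<alpha> * quad W x - s) * (g x - f x)"
    have nn: "0 \<le> ?d x" for x
    proof -
      have fx: "0 \<le> f x" "f x \<le> fX x" using f by (simp_all add: design_density_def)
      show ?thesis
      proof (cases "s \<le> \<psi> x")
        case True
        then have "0 \<le> \<alpha> * quad W x - s" "0 \<le> g x - f x" using fx by (simp_all add: psi g_def)
        then show ?thesis by (rule mult_nonneg_nonneg)
      next
        case False
        then have "\<alpha> * quad W x - s \<le> 0" "g x - f x \<le> 0" using fx by (simp_all add: psi g_def)
        then show ?thesis by (rule mult_nonpos_nonpos)
      qed
    qed
    have int: "integrable lborel ?d" "(LINT x|lborel. ?d x) \<le> 0"
      using threshold_integral[OF f g, of W s] optimal_directional[OF f g _ W] opt alpha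
      by (auto simp: has_bochner_integral_iff mult_le_0_iff)
    moreover have "0 \<le> (LINT x|lborel. ?d x)" using nn by simp
    ultimately have "(LINT x|lborel. ?d x) = 0" by linarith
    then have "AE x in lborel. ?d x = 0"
      by (rule iffD1[OF integral_nonneg_eq_0_iff_AE[OF int(1)], rotated]) (simp add: nn)
    \<comment> \<open>Off the finite level set the first factor is nonzero, so the second one
      vanishes.\<close>
    then have "AE x in lborel. f x = g x"
      using AE_lborel_finite[OF level[of s]] by eventually_elim (auto simp: psi)
    then show "\<exists>s. AE x in lborel. f x = (if s \<le> \<psi> x then fX x else 0)"
      unfolding g_def by blast
  next
    assume "\<exists>s. AE x in lborel. f x = (if s \<le> \<psi> x then fX x else 0)"
    then obtain s where s: "AE x in lborel. f x = (if s \<le> \<psi> x then fX x else 0)" by blast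
    show "\<forall>g. design_density g \<longrightarrow> ln (det (moment_mat g)) \<le> ln (det (moment_mat f))"
    proof (intro allI impI)
      fix g assume g: "design_density g"
      let ?d = "\<lambda>x. (\<alpha> * quad W x - s) * (g x - f x)"
      have "AE x in lborel. ?d x \<le> 0"
        using s
      proof eventually_elim
        case (elim x)
        have gx: "0 \<le> g x" "g x \<le> fX x" using g by (simp_all add: design_density_def)
        show ?case
        proof (cases "s \<le> \<psi> x")
          case True
          then have "0 \<le> \<alpha> * quad W x - s" "g x - f x \<le> 0" using gx elim by (simp_all add: psi)
          then show ?thesis by (rule mult_nonneg_nonpos)
        next
          case False
          then have "\<alpha> * quad W x - s \<le> 0" "0 \<le> g x - f x" using gx elim by (simp_all add: psi)
          then show ?thesis by (rule mult_nonpos_nonneg)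
        qed
      qed
      then have "(LINT x|lborel. ?d x) \<le> (LINT x::real|lborel. 0)"
        using threshold_integral[OF f g, of W s] by (intro integral_mono_AE) (auto simp: has_bochner_integral_iff)
      then have "(LINT x|lborel. quad W x * g x) - (LINT x|lborel. quad W x * f x) \<le> 0"
        using threshold_integral[OF f g, of W s] alpha by (simp add: has_bochner_integral_iff mult_le_0_iff)
      then show "ln (det (moment_mat g)) \<le> ln (det (moment_mat f))"
        using ln_det_moment_le[OF f g W] by linarith
    qed
  qed
  then show ?thesis unfolding \<psi>_def .
qed

lemma D_optimal_density_iff:
  assumes f: "design_density f"
  shows "D_optimal q fX \<alpha> (density lborel (\<lambda>x. ennreal (f x))) \<longleftrightarrow>
    (\<forall>g. design_density g \<longrightarrow> ln (det (moment_mat g)) \<le> ln (det (moment_mat f)))"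
proof -
  have "D_optimal q fX \<alpha> (density lborel (\<lambda>x. ennreal (f x))) \<longleftrightarrow>
    (\<forall>g. design_density g \<longrightarrow> ln (det (info_matrix q (density lborel (\<lambda>x. ennreal (g x))))) \<le>
       ln (det (info_matrix q (density lborel (\<lambda>x. ennreal (f x))))))"
    unfolding D_optimal_def subsampling_design_iff using f by blast
  then show ?thesis by (simp add: info_matrix_density f)
qed

text \<open>The set below the threshold is the negativity set of a polynomial. It is bounded by the
  growth of the sensitivity, and nonempty because otherwise \<open>f\<close> would equal
  \<open>fX\<close> almost everywhere and have mass 1.\<close>

lemma threshold_settings:
  assumes f: "design_density f"
    and s: "AE x in lborel. f x = (if s \<le> sensitivity q \<alpha> (density lborel (\<lambda>x. ennreal (f x))) x then fX x else 0)"
  shows "\<exists>r a. 1 \<le> r \<and> r \<le> q \<and> ordered_settings a r \<and>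
    (\<Union>k\<in>{0..r}. support_interval a r k) = {x. s \<le> sensitivity q \<alpha> (density lborel (\<lambda>x. ennreal (f x))) x}"
proof -
  define \<psi> where "\<psi> = sensitivity q \<alpha> (density lborel (\<lambda>x. ennreal (f x)))"
  obtain p where p: "degree p \<le> 2 * q" "\<And>x. poly p x = \<psi> x"
    using sensitivity_poly[OF f] unfolding \<psi>_def by blast
  have neg_set: "poly (p - [:s:]) x < 0 \<longleftrightarrow> \<psi> x < s" for x by (simp add: p(2))
  obtain B where B: "\<forall>x. \<psi> x < s \<longrightarrow> \<bar>x\<bar> \<le> B"
    using sensitivity_sublevel_bounded[OF f] unfolding \<psi>_def by blast
  have nonempty: "{x. poly (p - [:s:]) x < 0} \<noteq> {}"
  proof
    assume "{x. poly (p - [:s:]) x < 0} = {}"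
    then have "s \<le> \<psi> x" for x using neg_set[of x] by auto
    then have "AE x in lborel. f x = fX x" using s unfolding \<psi>_def[symmetric] by simp
    then have "(LINT x|lborel. f x) = (LINT x|lborel. fX x)"
      using design_densityD[OF f] by (intro integral_cong_AE) auto
    then show False using f fX_prob alpha by (simp add: design_density_def has_bochner_integral_iff)
  qed
  have deg: "degree (p - [:s:]) \<le> 2 * q" using p(1) by (intro degree_diff_le) auto
  have bound: "\<forall>x. poly (p - [:s:]) x < 0 \<longrightarrow> \<bar>x\<bar> \<le> B" using B neg_set by blast
  obtain r a where ra: "1 \<le> r" "r \<le> q" "ordered_settings a r"
    and set: "{x. poly (p - [:s:]) x < 0} = (\<Union>k\<in>{1..r}. {a (2 * k)<..<a (2 * k - 1)})"
    using poly_negative_set[OF deg nonempty bound] by (elim exE conjE) (rule that)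
  have "(\<Union>k\<in>{0..r}. support_interval a r k) = - {x. \<psi> x < s}"
    unfolding support_intervals_complement[OF ra(3,1)] set[symmetric] neg_set by (rule refl)
  also have "\<dots> = {x. s \<le> \<psi> x}" by auto
  finally show ?thesis using ra unfolding \<psi>_def
    by (intro exI[of _ r] exI[of _ a] conjI)
qed

end

theorem theorem3p1:
  fixes q :: nat and \<alpha> :: real and fX :: "real \<Rightarrow> real" and \<xi> :: "real measure"
  assumes "q \<ge> 1" and "0 < \<alpha>" and "\<alpha> < 1"
    and "fX \<in> borel_measurable lborel" and "\<And>x. 0 \<le> fX x"
    and "has_bochner_integral lborel fX 1"
    and "integrable lborel (\<lambda>x. \<bar>x\<bar> ^ (2 * q) * fX x)"
    and "subsampling_design fX \<alpha> \<xi>"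
  shows "D_optimal q fX \<alpha> \<xi> \<longleftrightarrow>
    (\<exists>(s::real) (r::nat) (a::nat \<Rightarrow> real) (X::real set).
       1 \<le> r \<and> r \<le> q \<and> ordered_settings a r \<and>
       X = (\<Union>k\<in>{0..r}. support_interval a r k) \<and>
       \<xi> = density lborel (\<lambda>x. ennreal (if x \<in> X then fX x else 0)) \<and>
       (\<forall>x\<in>X. sensitivity q \<alpha> \<xi> x \<ge> s) \<and>
       (\<forall>x. x \<notin> X \<longrightarrow> sensitivity q \<alpha> \<xi> x < s))"
proof -
  interpret covariate q \<alpha> fX
    using assms by unfold_locales auto
  obtain f where f: "design_density f" and \<xi>: "\<xi> = density lborel (\<lambda>x. ennreal (f x))"
    using assms(8) unfolding subsampling_design_iff by blast
  have f_borel [measurable]: "f \<in> borel_measurable borel" by (rule design_densityD[OF f])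
  have [measurable]: "sensitivity q \<alpha> \<xi> \<in> borel_measurable borel"
    unfolding \<xi> by (rule sensitivity_borel[OF f])
  have optimal: "D_optimal q fX \<alpha> \<xi> \<longleftrightarrow>
      (\<exists>s. AE x in lborel. f x = (if s \<le> sensitivity q \<alpha> \<xi> x then fX x else 0))"
    unfolding \<xi> D_optimal_density_iff[OF f] by (rule optimal_iff_threshold[OF f])
  \<comment> \<open>Uniqueness of densities turns the almost everywhere identity into an equation
    between measures.\<close>
  have AE_iff: "(AE x in lborel. f x = (if s \<le> sensitivity q \<alpha> \<xi> x then fX x else 0)) \<longleftrightarrow>
      \<xi> = density lborel (\<lambda>x. ennreal (if s \<le> sensitivity q \<alpha> \<xi> x then fX x else 0))" for s
  proof -
    have "\<xi> = density lborel (\<lambda>x. ennreal (if s \<le> sensitivity q \<alpha> \<xi> x then fX x else 0)) \<longleftrightarrow>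
        (AE x in lborel. ennreal (f x) = ennreal (if s \<le> sensitivity q \<alpha> \<xi> x then fX x else 0))"
      by (subst (1) \<xi>, rule sigma_finite_measure.density_unique_iff[OF sigma_finite_lborel]) measurable
    also have "\<dots> \<longleftrightarrow> (AE x in lborel. f x = (if s \<le> sensitivity q \<alpha> \<xi> x then fX x else 0))"
    proof (rule AE_cong)
      fix x
      have "0 \<le> f x" using f by (simp add: design_density_def)
      then show "ennreal (f x) = ennreal (if s \<le> sensitivity q \<alpha> \<xi> x then fX x else 0) \<longleftrightarrow>
          f x = (if s \<le> sensitivity q \<alpha> \<xi> x then fX x else 0)"
        using fX_nonneg[of x] by (intro ennreal_inj) auto
    qed
    finally show ?thesis by blast
  qed
  show ?thesis
  proof
    assume "D_optimal q fX \<alpha> \<xi>"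
    then obtain s where s: "AE x in lborel. f x = (if s \<le> sensitivity q \<alpha> \<xi> x then fX x else 0)"
      using optimal by blast
    obtain r a where ra: "1 \<le> r" "r \<le> q" "ordered_settings a r"
      "(\<Union>k\<in>{0..r}. support_interval a r k) = {x. s \<le> sensitivity q \<alpha> \<xi> x}"
      using threshold_settings[OF f s[unfolded \<xi>]] unfolding \<xi> by blast
    have dens: "\<xi> = density lborel (\<lambda>x. ennreal (if x \<in> {x. s \<le> sensitivity q \<alpha> \<xi> x} then fX x else 0))"
      using s AE_iff by simp
    show "\<exists>(s::real) (r::nat) (a::nat \<Rightarrow> real) (X::real set).
       1 \<le> r \<and> r \<le> q \<and> ordered_settings a r \<and>
       X = (\<Union>k\<in>{0..r}. support_interval a r k) \<and>
       \<xi> = density lborel (\<lambda>x. ennreal (if x \<in> X then fX x else 0)) \<and>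
       (\<forall>x\<in>X. sensitivity q \<alpha> \<xi> x \<ge> s) \<and>
       (\<forall>x. x \<notin> X \<longrightarrow> sensitivity q \<alpha> \<xi> x < s)"
      by (rule exI[of _ s], rule exI[of _ r], rule exI[of _ a],
          rule exI[of _ "{x. s \<le> sensitivity q \<alpha> \<xi> x}"], intro conjI)
        (use ra dens in auto)
  next
    assume "\<exists>(s::real) (r::nat) (a::nat \<Rightarrow> real) (X::real set).
       1 \<le> r \<and> r \<le> q \<and> ordered_settings a r \<and>
       X = (\<Union>k\<in>{0..r}. support_interval a r k) \<and>
       \<xi> = density lborel (\<lambda>x. ennreal (if x \<in> X then fX x else 0)) \<and>
       (\<forall>x\<in>X. sensitivity q \<alpha> \<xi> x \<ge> s) \<and>
       (\<forall>x. x \<notin> X \<longrightarrow> sensitivity q \<alpha> \<xi> x < s)"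
    then obtain s X where X: "\<xi> = density lborel (\<lambda>x. ennreal (if x \<in> X then fX x else 0))"
      "\<forall>x\<in>X. sensitivity q \<alpha> \<xi> x \<ge> s" "\<forall>x. x \<notin> X \<longrightarrow> sensitivity q \<alpha> \<xi> x < s"
      by blast
    \<comment> \<open>The two sensitivity conditions identify \<open>X\<close> as a superlevel set,
      which brings the density into threshold form.\<close>
    have X_iff: "x \<in> X \<longleftrightarrow> s \<le> sensitivity q \<alpha> \<xi> x" for x
      using X(2,3) by (meson not_less)
    have "\<xi> = density lborel (\<lambda>x. ennreal (if s \<le> sensitivity q \<alpha> \<xi> x then fX x else 0))"
      using X(1) unfolding X_iff .
    then show "D_optimal q fX \<alpha> \<xi>" using AE_iff optimal by blast
  qed
qed

end
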